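(* Let $n=3$ and $C_J=1$ for every nonempty $J\subseteq\{1,2,3\}$. Up to relabeling of the messages (with their receivers), every distributed index coding problem with $n=3$ is one of the problems listed below, where $(j|A_j)$ means that receiver $j$ wants message $j$ and has side information $A_j$, and $(j)$ means $A_j=\emptyset$. The capacity region of each is the set of all $(R_1,R_2,R_3)$ with $R_1,R_2,R_3\ge0$, $R_1\le4$, $R_2\le4$, $R_3\le4$ that satisfy in addition the following inequalities: (i) for $(1);(2);(3)$; $(1|2);(2);(3)$; $(1|2,3);(2);(3)$; $(1);(2|3);(3|1)$; $(1);(2|1);(3|1)$; and $(1);(2|1);(3|1,2)$: $R_1+R_2\le6$, $R_1+R_3\le6$, $R_2+R_3\le6$, $R_1+R_2+R_3\le7$; (ii) for $(1|3);(2|1);(3|2)$: $R_1+R_2\le6$, $R_1+R_3\le6$, $R_2+R_3\le6$, $R_1+R_2+R_3\le9$; (iii) for $(1);(2|3);(3|2)$; $(1);(2|1,3);(3|2)$; and $(1);(2|1,3);(3|1,2)$: $R_1+R_2\le6$, $R_1+R_3\le6$, $R_2+R_3\le8$, $R_1+R_2+R_3\le9$; (iv) for $(1|3);(2|3);(3|2)$; $(1|3);(2|1,3);(3|2)$; and $(1|2,3);(2|3);(3|2)$: $R_1+R_2\le6$, $R_1+R_3\le6$, $R_2+R_3\le8$, $R_1+R_2+R_3\le10$; (v) for $(1|3);(2|3);(3|1,2)$ and $(1|2,3);(2|3);(3|1,2)$: $R_1+R_2\le6$, $R_1+R_3\le8$, $R_2+R_3\le8$, $R_1+R_2+R_3\le10$;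 (vi) for $(1|2,3);(2|1,3);(3|1,2)$: $R_1+R_2\le8$, $R_1+R_3\le8$, $R_2+R_3\le8$, $R_1+R_2+R_3\le12$.
   Context: Distributed index coding. $[n]=\{1,\dots,n\}$ and $N=\{J\subseteq[n] : J\neq\emptyset\}$. There are $n$ messages $x_j\in\{0,1\}^{t_j}$, $j\in[n]$ ($t_j$ nonnegative integers), and $n$ receivers; receiver $j$ wants $x_j$ and knows a priori the messages $x(A_j)=(x_i)_{i\in A_j}$, where $A_j\subseteq[n]\setminus\{j\}$. For each $J\in N$ there is a server holding exactly the messages $x_i$, $i\in J$; it broadcasts noiselessly to all receivers a sequence $y_J\in\{0,1\}^{u_J}$ ($u_J$ a nonnegative integer) that is a function of $(x_i)_{i\in J}$. Receiver $j$ must recover $x_j$ exactly as a function of $(y_J)_{J\in N}$ and $x(A_j)$, for every realization of the messages. A code consists of such lengths, encoding functions and decoding functions. With link capacities $C_J\ge 0$, the tuple $(\mathbf{R},\mathbf{C})=((R_j)_{j\in[n]},(C_J)_{J\in N})$ is achievable if there exist such a code and some $r>0$ with $R_j\le t_j/r$ for all $j\in[n]$ and $C_J\ge u_J/r$ for all $J\in N$. For given $\mathbf{C}$, the capacity region is the closure of the set of (nonnegative) rate tuples $\mathbf{R}$ such that $(\mathbf{R},\mathbf{C})$ is achievable. *)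

theory Defs
  imports "HOL-Analysis.Analysis"
begin

text \<open>
  Messages and receivers are indexed by a finite type \<open>'n\<close>, which stands for
  \<open>{1,\<dots>,n}\<close> with \<open>n = CARD('n)\<close>; servers are indexed by the nonempty sets
  \<open>J :: 'n set\<close>. For \<open>n = 3\<close> the index type is the numeral type \<open>3\<close>: its elements
  \<open>1\<close>, \<open>2\<close>, \<open>3\<close> are pairwise distinct and exhaust it (\<open>UNIV_3\<close>), although as an
  element of that type \<open>3 = 0\<close>.
\<close>

definition side_information :: "('n \<Rightarrow> 'n set) \<Rightarrow> bool" where
  "side_information A \<longleftrightarrow> (\<forall>j. j \<notin> A j)"

definition messages :: "('n \<Rightarrow> nat) \<Rightarrow> ('n \<Rightarrow> bool list) set" where
  "messages t = {x. \<forall>j. length (x j) = t j}"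

definition servers :: "'n set set" where
  "servers = {J. J \<noteq> {}}"

text \<open>
  Encoders and decoders are applied to restricted tuples only, so that server \<open>J\<close> sees
  nothing but \<open>(x\<^sub>i)\<close> for \<open>i \<in> J\<close>, and receiver \<open>j\<close> nothing but the broadcast sequences
  and \<open>(x\<^sub>i)\<close> for \<open>i \<in> A j\<close>.
\<close>

definition broadcast ::
  "('n set \<Rightarrow> ('n \<Rightarrow> bool list) \<Rightarrow> bool list) \<Rightarrow> ('n \<Rightarrow> bool list) \<Rightarrow> 'n set \<Rightarrow> bool list" where
  "broadcast enc x = (\<lambda>J\<in>servers. enc J (restrict x J))"

definition is_code ::
  "('n \<Rightarrow> 'n set) \<Rightarrow> ('n \<Rightarrow> nat) \<Rightarrow> ('n set \<Rightarrow> nat) \<Rightarrow>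
   ('n set \<Rightarrow> ('n \<Rightarrow> bool list) \<Rightarrow> bool list) \<Rightarrow>
   ('n \<Rightarrow> ('n set \<Rightarrow> bool list) \<Rightarrow> ('n \<Rightarrow> bool list) \<Rightarrow> bool list) \<Rightarrow> bool" where
  "is_code A t u enc dec \<longleftrightarrow>
     (\<forall>x\<in>messages t.
        (\<forall>J\<in>servers. length (broadcast enc x J) = u J) \<and>
        (\<forall>j. dec j (broadcast enc x) (restrict x (A j)) = x j))"

definition achievable ::
  "('n::finite \<Rightarrow> 'n set) \<Rightarrow> real ^ 'n \<Rightarrow> ('n set \<Rightarrow> real) \<Rightarrow> bool" where
  "achievable A R C \<longleftrightarrow>
     (\<exists>t u enc dec (r::real). is_code A t u enc dec \<and> r > 0 \<and>
        (\<forall>j. R $ j \<le> real (t j) / r) \<and>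
        (\<forall>J\<in>servers. C J \<ge> real (u J) / r))"

definition capacity_region ::
  "('n::finite \<Rightarrow> 'n set) \<Rightarrow> ('n set \<Rightarrow> real) \<Rightarrow> (real ^ 'n) set" where
  "capacity_region A C = closure {R. (\<forall>j. 0 \<le> R $ j) \<and> achievable A R C}"

definition is_relabeling :: "('n \<Rightarrow> 'n set) \<Rightarrow> ('n \<Rightarrow> 'n set) \<Rightarrow> bool" where
  "is_relabeling A B \<longleftrightarrow> (\<exists>p. bij p \<and> (\<forall>j. A (p j) = p ` B j))"

text \<open>\<open>problem A\<^sub>1 A\<^sub>2 A\<^sub>3\<close> is the problem written \<open>(1|A\<^sub>1);(2|A\<^sub>2);(3|A\<^sub>3)\<close>.\<close>

definition problem :: "3 set \<Rightarrow> 3 set \<Rightarrow> 3 set \<Rightarrow> 3 \<Rightarrow> 3 set" where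
  "problem A1 A2 A3 = (\<lambda>j. if j = 1 then A1 else if j = 2 then A2 else A3)"

definition problems_i :: "(3 \<Rightarrow> 3 set) set" where
  "problems_i =
     {problem {} {} {}, problem {2} {} {}, problem {2, 3} {} {},
      problem {} {3} {1}, problem {} {1} {1}, problem {} {1} {1, 2}}"

definition problems_ii :: "(3 \<Rightarrow> 3 set) set" where
  "problems_ii = {problem {3} {1} {2}}"

definition problems_iii :: "(3 \<Rightarrow> 3 set) set" where
  "problems_iii =
     {problem {} {3} {2}, problem {} {1, 3} {2}, problem {} {1, 3} {1, 2}}"

definition problems_iv :: "(3 \<Rightarrow> 3 set) set" where
  "problems_iv =
     {problem {3} {3} {2}, problem {3} {1, 3} {2}, problem {2, 3} {3} {2}}"

definition problems_v :: "(3 \<Rightarrow> 3 set) set" where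
  "problems_v = {problem {3} {3} {1, 2}, problem {2, 3} {3} {1, 2}}"

definition problems_vi :: "(3 \<Rightarrow> 3 set) set" where
  "problems_vi = {problem {2, 3} {1, 3} {1, 2}}"

definition rate_region :: "real \<Rightarrow> real \<Rightarrow> real \<Rightarrow> real \<Rightarrow> (real ^ 3) set" where
  "rate_region b12 b13 b23 b123 =
     {R. 0 \<le> R $ 1 \<and> 0 \<le> R $ 2 \<and> 0 \<le> R $ 3 \<and>
         R $ 1 \<le> 4 \<and> R $ 2 \<le> 4 \<and> R $ 3 \<le> 4 \<and>
         R $ 1 + R $ 2 \<le> b12 \<and> R $ 1 + R $ 3 \<le> b13 \<and> R $ 2 + R $ 3 \<le> b23 \<and>
         R $ 1 + R $ 2 + R $ 3 \<le> b123}"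

end

theory Submission
  imports Defs
begin

text \<open>
  Inner bounds: time sharing makes the capacity region convex, and it is downward closed, so it
  suffices to achieve finitely many integer rate triples with one bit per server. Each server sends
  either one bit, or the sum of the bits of a set of messages any two of whose receivers know each
  other's message, or one of two sums \<open>x\<^sub>i + x\<^sub>j\<close>, \<open>x\<^sub>j + x\<^sub>k\<close> jointly sent by two servers to three
  receivers each of which knows another one's message.

  Outer bounds: setting messages outside a set \<open>K\<close> to zero and counting broadcasts bounds the rate
  sum over \<open>K\<close> by the total capacity of the servers meeting \<open>K\<close>, provided the side information is
  acyclic on \<open>K\<close>. The bound \<open>9\<close> in (iii) counts in addition what the servers holding \<open>2\<close> and \<open>3\<close>
  would send if \<open>x\<^sub>2\<close> were zero. All other bounds follow from these.
\<close>

subsection \<open>Decodability\<close>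

text \<open>Decodability without decoders: a receiver can decode exactly when its wanted message is
  determined by the broadcast and its side information. Constructions and counting arguments then
  deal with encoders only.\<close>

definition encodes ::
  "('n \<Rightarrow> 'n set) \<Rightarrow> ('n \<Rightarrow> nat) \<Rightarrow> ('n set \<Rightarrow> nat) \<Rightarrow>
   ('n set \<Rightarrow> ('n \<Rightarrow> bool list) \<Rightarrow> bool list) \<Rightarrow> bool" where
  "encodes A t u enc \<longleftrightarrow>
     (\<forall>x\<in>messages t. \<forall>J\<in>servers. length (enc J (restrict x J)) = u J) \<and>
     (\<forall>x\<in>messages t. \<forall>y\<in>messages t. \<forall>j.
        (\<forall>J\<in>servers. enc J (restrict x J) = enc J (restrict y J)) \<longrightarrow>
        (\<forall>i\<in>A j. x i = y i) \<longrightarrow> x j = y j)"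

definition codable :: "('n \<Rightarrow> 'n set) \<Rightarrow> ('n \<Rightarrow> nat) \<Rightarrow> ('n set \<Rightarrow> nat) \<Rightarrow> bool" where
  "codable A t u \<longleftrightarrow> (\<exists>enc. encodes A t u enc)"

lemma encodes_length:
  "encodes A t u enc \<Longrightarrow> x \<in> messages t \<Longrightarrow> J \<in> servers \<Longrightarrow> length (enc J (restrict x J)) = u J"
  by (simp add: encodes_def)

lemma encodes_separates:
  assumes "encodes A t u enc" "x \<in> messages t" "y \<in> messages t"
    and "\<And>J. J \<in> servers \<Longrightarrow> enc J (restrict x J) = enc J (restrict y J)"
    and "\<And>i. i \<in> A j \<Longrightarrow> x i = y i"
  shows "x j = y j"
  using assms unfolding encodes_def by simp

lemma codable_iff_is_code: "codable A t u \<longleftrightarrow> (\<exists>enc dec. is_code A t u enc dec)"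
proof
  assume "codable A t u"
  then obtain enc where enc: "encodes A t u enc"
    unfolding codable_def by blast
  \<comment> \<open>The decoder reads coordinate \<open>j\<close> off an arbitrary tuple consistent
    with what was received; all consistent tuples agree there.\<close>
  define dec where "dec j b s =
      (SOME x. x \<in> messages t \<and> broadcast enc x = b \<and> restrict x (A j) = s) j" for j b s
  have "dec j (broadcast enc x) (restrict x (A j)) = x j" if x: "x \<in> messages t" for x j
  proof -
    let ?P = "\<lambda>y. y \<in> messages t \<and> broadcast enc y = broadcast enc x \<and>
      restrict y (A j) = restrict x (A j)"
    have P: "?P (SOME y. ?P y)"
      by (rule someI[of ?P x]) (use x in auto)
    have "(SOME y. ?P y) j = x j"
    proof (rule encodes_separates[OF enc, where x = "SOME y. ?P y" and y = x])
      show "enc J (restrict (SOME y. ?P y) J) = enc J (restrict x J)"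
        if "J \<in> servers" for J
      proof -
        have "broadcast enc (SOME y. ?P y) J = broadcast enc x J"
          using P by simp
        then show ?thesis using that by (simp add: broadcast_def)
      qed
      show "(SOME y. ?P y) i = x i" if "i \<in> A j" for i
      proof -
        have "restrict (SOME y. ?P y) (A j) i = restrict x (A j) i"
          using P by simp
        then show ?thesis using that by simp
      qed
    qed (use P x in auto)
    then show ?thesis by (simp add: dec_def)
  qed
  then have "is_code A t u enc dec"
    using encodes_length[OF enc] by (simp add: is_code_def broadcast_def)
  then show "\<exists>enc dec. is_code A t u enc dec" by blast
next
  assume "\<exists>enc dec. is_code A t u enc dec"
  then obtain enc dec where c: "is_code A t u enc dec" by blast
  show "codable A t u"
    unfolding codable_def encodes_def
  proof (intro exI[of _ enc] conjI ballI allI impI)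
    fix x J assume "x \<in> messages t" "J \<in> (servers :: 'a set set)"
    then show "length (enc J (restrict x J)) = u J"
      using c by (auto simp: is_code_def broadcast_def)
  next
    fix x y j
    assume xy: "x \<in> messages t" "y \<in> messages t"
      and b: "\<forall>J\<in>servers. enc J (restrict x J) = enc J (restrict y J)"
      and s: "\<forall>i\<in>A j. x i = y i"
    have "broadcast enc x = broadcast enc y"
      using b by (auto simp: broadcast_def intro!: restrict_ext)
    moreover have "restrict x (A j) = restrict y (A j)"
      using s by (auto intro!: restrict_ext)
    ultimately show "x j = y j"
      using c xy unfolding is_code_def by metis
  qed
qed

lemma achievable_iff_codable:
  "achievable A R C \<longleftrightarrow> (\<exists>t u (r::real). codable A t u \<and> r > 0 \<and>
     (\<forall>j. R $ j \<le> real (t j) / r) \<and> (\<forall>J\<in>servers. C J \<ge> real (u J) / r))"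
  unfolding achievable_def codable_iff_is_code by blast

section \<open>Running codes side by side\<close>

lemma codable_zero: "codable A (\<lambda>_. 0) (\<lambda>_. 0)"
  unfolding codable_def encodes_def by (intro exI[of _ "\<lambda>_ _. []"]) (auto simp: messages_def)

text \<open>Each message is cut after its first \<open>t i\<close> bits, the two parts go through
  the two codes, and every server concatenates its two outputs.\<close>

lemma codable_add:
  assumes "codable A t u" "codable A t' u'"
  shows "codable A (\<lambda>j. t j + t' j) (\<lambda>J. u J + u' J)"
proof -
  obtain f where f: "encodes A t u f"
    using assms(1) unfolding codable_def by blast
  obtain g where g: "encodes A t' u' g"
    using assms(2) unfolding codable_def by blast
  define fst_part where "fst_part x = (\<lambda>i. take (t i) (x i))" for x :: "'a \<Rightarrow> bool list"
  define snd_part where "snd_part x = (\<lambda>i. drop (t i) (x i))" for x :: "'a \<Rightarrow> bool list"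
  define h where "h J z = f J (restrict (fst_part z) J) @ g J (restrict (snd_part z) J)" for J z
  \<comment> \<open>Cutting acts on each message separately, so it commutes with restricting to what
    server \<open>J\<close> holds.\<close>
  have h_restrict: "h J (restrict x J) =
      f J (restrict (fst_part x) J) @ g J (restrict (snd_part x) J)" for J x
    by (simp add: h_def fst_part_def snd_part_def cong: restrict_cong)
  have parts: "fst_part x \<in> messages t" "snd_part x \<in> messages t'"
    if "x \<in> messages (\<lambda>j. t j + t' j)" for x
    using that by (auto simp: messages_def fst_part_def snd_part_def)
  show ?thesis
    unfolding codable_def encodes_def
  proof (intro exI[of _ h] conjI ballI allI impI)
    fix x J assume "x \<in> messages (\<lambda>j. t j + t' j)" "J \<in> (servers :: 'a set set)"
    then show "length (h J (restrict x J)) = u J + u' J"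
      by (simp add: h_restrict encodes_length[OF f] encodes_length[OF g] parts)
  next
    fix x y j
    assume x: "x \<in> messages (\<lambda>j. t j + t' j)" and y: "y \<in> messages (\<lambda>j. t j + t' j)"
      and b: "\<forall>J\<in>servers. h J (restrict x J) = h J (restrict y J)"
      and s: "\<forall>i\<in>A j. x i = y i"
    \<comment> \<open>Both outputs of \<open>f\<close> have length \<open>u J\<close>, so equal
      concatenations have equal halves.\<close>
    have fg: "f J (restrict (fst_part x) J) = f J (restrict (fst_part y) J) \<and>
      g J (restrict (snd_part x) J) = g J (restrict (snd_part y) J)" if "J \<in> servers" for J
      using b that x y by (simp add: h_restrict encodes_length[OF f] parts)
    have "fst_part x j = fst_part y j"
      by (rule encodes_separates[OF f]) (use fg s parts x y in \<open>auto simp: fst_part_def\<close>)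
    moreover have "snd_part x j = snd_part y j"
      by (rule encodes_separates[OF g]) (use fg s parts x y in \<open>auto simp: snd_part_def\<close>)
    ultimately show "x j = y j"
      unfolding fst_part_def snd_part_def by (metis append_take_drop_id)
  qed
qed

lemma codable_scale:
  assumes "codable A t u"
  shows "codable A (\<lambda>j. k * t j) (\<lambda>J. k * u J)"
proof (induction k)
  case 0
  then show ?case using codable_zero by simp
next
  case (Suc k)
  then show ?case using codable_add[OF assms] by simp
qed

section \<open>Elementary codes with one-bit messages\<close>

text \<open>Server \<open>J\<close> sends the XOR of the bits in \<open>K\<close>, written as the
  parity of the number of ones. Each receiver in \<open>K\<close> cancels the other bits, all of
  which it knows.\<close>

lemma codable_clique:
  fixes A :: "'n::finite \<Rightarrow> 'n set"
  assumes "J \<noteq> {}" "K \<subseteq> J" and clique: "\<And>j. j \<in> K \<Longrightarrow> K - {j} \<subseteq> A j"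
  shows "codable A (\<lambda>j. of_bool (j \<in> K)) (\<lambda>J'. of_bool (J' = J))"
  unfolding codable_def encodes_def
proof (intro exI[of _ "\<lambda>J' z. if J' = J then [odd (card {i\<in>K. z i = [True]})] else []"]
    conjI ballI allI impI)
  fix x y :: "'n \<Rightarrow> bool list" and j
  let ?enc = "\<lambda>J' z. if J' = J then [odd (card {i\<in>K. z i = [True]})] else []"
  assume x: "x \<in> messages (\<lambda>j. of_bool (j \<in> K))" and y: "y \<in> messages (\<lambda>j. of_bool (j \<in> K))"
    and b: "\<forall>J'\<in>servers. ?enc J' (restrict x J') = ?enc J' (restrict y J')"
    and s: "\<forall>i\<in>A j. x i = y i"
  show "x j = y j"
  proof (cases "j \<in> K")
    case False
    then have "length (x j) = 0" "length (y j) = 0"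
      using x y unfolding messages_def by auto
    then show ?thesis by simp
  next
    case True
    \<comment> \<open>\<open>restrict\<close> yields \<open>undefined\<close> outside
      \<open>J\<close>; since \<open>K\<close> lies inside \<open>J\<close>, the parity never
      depends on it.\<close>
    have restr: "{i\<in>K. (if i \<in> J then z i else undefined) = [True]} = {i\<in>K. z i = [True]}"
      for z :: "'n \<Rightarrow> bool list"
      using \<open>K \<subseteq> J\<close> by auto
    have parity: "odd (card {i\<in>K. x i = [True]}) = odd (card {i\<in>K. y i = [True]})"
      using bspec[OF b, of J] \<open>J \<noteq> {}\<close> by (simp add: servers_def restr)
    let ?D = "{i\<in>K - {j}. x i = [True]}"
    \<comment> \<open>\<open>?D\<close> is formed from \<open>x\<close> alone but serves every
      \<open>z\<close> agreeing with \<open>x\<close> on \<open>A j\<close>: it is the contribution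
      that receiver \<open>j\<close> can cancel.\<close>
    have split: "odd (card {i\<in>K. z i = [True]}) \<longleftrightarrow> (z j = [True]) \<noteq> odd (card ?D)"
      if "\<forall>i\<in>A j. x i = z i" for z
    proof -
      have "{i\<in>K. z i = [True]} = (if z j = [True] then insert j ?D else ?D)"
        using that clique[OF True] True by auto
      then show ?thesis by auto
    qed
    have "x j = [True] \<longleftrightarrow> y j = [True]"
      using parity split[of x] split[of y] s by auto
    moreover have "length (x j) = 1" "length (y j) = 1"
      using x y True unfolding messages_def by simp_all
    then have "\<exists>a. x j = [a]" "\<exists>a. y j = [a]"
      by (simp_all add: length_Suc_conv)
    ultimately show ?thesis by auto
  qed
qed auto

text \<open>Once one of three bits is known, the two sums \<open>x\<^sub>i + x\<^sub>j\<close> and \<open>x\<^sub>j + x\<^sub>k\<close> reveal the others.\<close>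

lemma codable_two_sums:
  fixes A :: "'n::finite \<Rightarrow> 'n set"
  assumes dist: "i \<noteq> j" "i \<noteq> k" "j \<noteq> k" and J: "{i, j} \<subseteq> J" "{j, k} \<subseteq> J'" "J \<noteq> J'"
    and know: "A i \<inter> {j, k} \<noteq> {}" "A j \<inter> {i, k} \<noteq> {}" "A k \<inter> {i, j} \<noteq> {}"
  shows "codable A (\<lambda>l. of_bool (l \<in> {i, j, k})) (\<lambda>L. of_bool (L = J) + of_bool (L = J'))"
  unfolding codable_def encodes_def
proof (intro exI[of _ "\<lambda>L z. if L = J then [hd (z i) \<noteq> hd (z j)]
      else if L = J' then [hd (z j) \<noteq> hd (z k)] else []"] conjI ballI allI impI)
  fix x y :: "'n \<Rightarrow> bool list" and l
  let ?enc = "\<lambda>L (z :: 'n \<Rightarrow> bool list). if L = J then [hd (z i) \<noteq> hd (z j)]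
      else if L = J' then [hd (z j) \<noteq> hd (z k)] else []"
  assume x: "x \<in> messages (\<lambda>l. of_bool (l \<in> {i, j, k}))"
    and y: "y \<in> messages (\<lambda>l. of_bool (l \<in> {i, j, k}))"
    and b: "\<forall>L\<in>servers. ?enc L (restrict x L) = ?enc L (restrict y L)"
    and s: "\<forall>i\<in>A l. x i = y i"
  have sums: "(hd (x i) = hd (x j)) = (hd (y i) = hd (y j))"
      "(hd (x j) = hd (x k)) = (hd (y j) = hd (y k))"
    using bspec[OF b, of J] bspec[OF b, of J'] J by (auto simp: servers_def)
  show "x l = y l"
  proof (cases "l \<in> {i, j, k}")
    case False
    then have "length (x l) = 0" "length (y l) = 0"
      using x y unfolding messages_def by (auto simp: max_def)
    then show ?thesis by simp
  next
    case True
    have "hd (x l) = hd (y l)"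
      using True know s sums by auto
    moreover have "length (x l) = 1" "length (y l) = 1"
      using x y True unfolding messages_def by (auto simp: max_def)
    then have "\<exists>a. x l = [a]" "\<exists>a. y l = [a]"
      by (simp_all add: length_Suc_conv)
    ultimately show ?thesis by auto
  qed
qed (use J in auto)

subsection \<open>Time sharing\<close>

text \<open>Mixtures of achievable tuples are first placed in the closure; a second limit extends
  this to mixtures of limit points.\<close>

lemma convex_capacity_region: "convex (capacity_region A C)"
proof -
  define S where "S = {R. (\<forall>j. 0 \<le> R $ j) \<and> achievable A R C}"
  have mix: "a *\<^sub>R R + b *\<^sub>R R' \<in> closure S"
    if "R \<in> S" "R' \<in> S" and ab: "0 \<le> a" "0 \<le> b" "a + b = 1" for R R' a b
  proof -
    obtain t u r where c: "codable A t u" and r: "r > 0" and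
      R: "\<And>j. R $ j \<le> real (t j) / r" and C: "\<And>J. J \<in> servers \<Longrightarrow> real (u J) / r \<le> C J"
      using \<open>R \<in> S\<close> unfolding S_def achievable_iff_codable by blast
    obtain t' u' r' where c': "codable A t' u'" and r': "r' > 0" and
      R': "\<And>j. R' $ j \<le> real (t' j) / r'" and C': "\<And>J. J \<in> servers \<Longrightarrow> real (u' J) / r' \<le> C J"
      using \<open>R' \<in> S\<close> unfolding S_def achievable_iff_codable by blast
    have nonneg: "\<And>j. 0 \<le> R $ j" "\<And>j. 0 \<le> R' $ j"
      using that by (auto simp: S_def)
    \<comment> \<open>Use \<open>k m\<close> copies of one code and \<open>k' m\<close> of the other at scale \<open>Suc m\<close>;
      the scales \<open>r\<close>, \<open>r'\<close> are real, so the mixture is only reached in the limit.\<close>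
    define k where "k m = nat \<lfloor>real (Suc m) * (a / r)\<rfloor>" for m
    define k' where "k' m = nat \<lfloor>real (Suc m) * (b / r')\<rfloor>" for m
    have k_le: "real (k m) * r \<le> real (Suc m) * a" for m
    proof -
      have "real (k m) \<le> real (Suc m) * (a / r)"
        using ab r by (simp add: k_def)
      then show ?thesis using r by (simp add: field_simps)
    qed
    have k'_le: "real (k' m) * r' \<le> real (Suc m) * b" for m
    proof -
      have "real (k' m) \<le> real (Suc m) * (b / r')"
        using ab r' by (simp add: k'_def)
      then show ?thesis using r' by (simp add: field_simps)
    qed
    \<comment> \<open>Rounding down loses less than \<open>1\<close>, which vanishes after division
      by \<open>Suc m\<close>.\<close>
    have floor_lim: "(\<lambda>m. real (nat \<lfloor>real (Suc m) * c\<rfloor>) / real (Suc m)) \<longlonglongrightarrow> c"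
      if "0 \<le> c" for c
    proof (rule tendsto_sandwich)
      show "(\<lambda>m. c - 1 / real (Suc m)) \<longlonglongrightarrow> c"
        using tendsto_diff[OF tendsto_const LIMSEQ_inverse_real_of_nat, of c]
        by (simp add: inverse_eq_divide)
      show "\<forall>\<^sub>F m in sequentially. c - 1 / real (Suc m) \<le> real (nat \<lfloor>real (Suc m) * c\<rfloor>) / real (Suc m)"
      proof (intro always_eventually allI)
        fix m
        have "real (Suc m) * c - 1 \<le> real (nat \<lfloor>real (Suc m) * c\<rfloor>)"
          by linarith
        then have "(real (Suc m) * c - 1) / real (Suc m) \<le> real (nat \<lfloor>real (Suc m) * c\<rfloor>) / real (Suc m)"
          by (rule divide_right_mono) simp
        then show "c - 1 / real (Suc m) \<le> real (nat \<lfloor>real (Suc m) * c\<rfloor>) / real (Suc m)"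
          by (simp add: diff_divide_distrib)
      qed
      show "\<forall>\<^sub>F m in sequentially. real (nat \<lfloor>real (Suc m) * c\<rfloor>) / real (Suc m) \<le> c"
      proof (intro always_eventually allI)
        fix m
        have "real (nat \<lfloor>real (Suc m) * c\<rfloor>) \<le> real (Suc m) * c"
          using that by simp
        then show "real (nat \<lfloor>real (Suc m) * c\<rfloor>) / real (Suc m) \<le> c"
          by (simp add: field_simps)
      qed
    qed (rule tendsto_const)
    \<comment> \<open>A lower bound for the rates of the combined code, whose weights tend to
      \<open>a\<close> and \<open>b\<close>.\<close>
    define w where "w m = (real (k m) / real (Suc m) * r) *\<^sub>R R + (real (k' m) / real (Suc m) * r') *\<^sub>R R'" for m
    have "w m \<in> S" for m
    proof -
      have "codable A (\<lambda>j. k m * t j + k' m * t' j) (\<lambda>J. k m * u J + k' m * u' J)"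
        by (intro codable_add codable_scale c c')
      moreover have "w m $ j \<le> real (k m * t j + k' m * t' j) / real (Suc m)" for j
      proof -
        have "real (k m) * (r * R $ j) \<le> real (k m) * real (t j)"
          using R[of j] r by (intro mult_left_mono) (auto simp: field_simps)
        moreover have "real (k' m) * (r' * R' $ j) \<le> real (k' m) * real (t' j)"
          using R'[of j] r' by (intro mult_left_mono) (auto simp: field_simps)
        ultimately show ?thesis
          by (simp add: w_def add_divide_distrib[symmetric] divide_right_mono mult.assoc)
      qed
      moreover have "real (k m * u J + k' m * u' J) / real (Suc m) \<le> C J" if J: "J \<in> servers" for J
      proof -
        \<comment> \<open>The sign of \<open>C J\<close> allows the rounding estimates
          \<open>k_le\<close> and \<open>k'_le\<close> to be multiplied by it.\<close>
        have CJ: "0 \<le> C J" using order_trans[OF _ C[OF J]] r by simp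
        have "real (k m) * real (u J) \<le> real (k m) * (r * C J)"
          using C[OF J] r by (intro mult_left_mono) (auto simp: field_simps)
        also have "\<dots> \<le> real (Suc m) * a * C J"
          using mult_right_mono[OF k_le CJ] by (simp add: mult.assoc)
        finally have 1: "real (k m) * real (u J) \<le> real (Suc m) * a * C J" .
        have "real (k' m) * real (u' J) \<le> real (k' m) * (r' * C J)"
          using C'[OF J] r' by (intro mult_left_mono) (auto simp: field_simps)
        also have "\<dots> \<le> real (Suc m) * b * C J"
          using mult_right_mono[OF k'_le CJ] by (simp add: mult.assoc)
        finally have "real (k m * u J + k' m * u' J) \<le> real (Suc m) * (a + b) * C J"
          using 1 by (simp add: algebra_simps)
        then show ?thesis using ab by (simp add: field_simps)
      qed
      ultimately have "achievable A (w m) C"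
        unfolding achievable_iff_codable by (meson of_nat_0_less_iff zero_less_Suc)
      then show ?thesis
        using nonneg r r' by (simp add: S_def w_def)
    qed
    moreover have "w \<longlonglongrightarrow> (a / r * r) *\<^sub>R R + (b / r' * r') *\<^sub>R R'"
      unfolding w_def k_def k'_def using ab r r'
      by (intro tendsto_intros floor_lim) auto
    then have "w \<longlonglongrightarrow> a *\<^sub>R R + b *\<^sub>R R'"
      using r r' by simp
    ultimately show ?thesis
      unfolding closure_sequential by blast
  qed
  have "convex (closure S)"
  proof (rule convexI)
    fix x y and a b :: real
    assume xy: "x \<in> closure S" "y \<in> closure S" and ab: "0 \<le> a" "0 \<le> b" "a + b = 1"
    obtain X Y where X: "\<And>n. X n \<in> S" "X \<longlonglongrightarrow> x" and Y: "\<And>n. Y n \<in> S" "Y \<longlonglongrightarrow> y"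
      using xy unfolding closure_sequential by metis
    have "(\<lambda>n. a *\<^sub>R X n + b *\<^sub>R Y n) \<longlonglongrightarrow> a *\<^sub>R x + b *\<^sub>R y"
      by (intro tendsto_intros X Y)
    moreover have "a *\<^sub>R X n + b *\<^sub>R Y n \<in> closure S" for n
      by (rule mix[OF X(1) Y(1) ab])
    ultimately show "a *\<^sub>R x + b *\<^sub>R y \<in> closure S"
      by (rule closed_sequentially[OF closed_closure, rotated])
  qed
  then show ?thesis by (simp add: capacity_region_def S_def)
qed

text \<open>Achievability only asks for rates at most those of a code, so an approximating sequence
  for \<open>R'\<close> may be capped coordinatewise at \<open>R\<close>; the capped sequence tends
  to \<open>R\<close>.\<close>

lemma capacity_region_downward:
  assumes R': "R' \<in> capacity_region A C" and "\<And>j. 0 \<le> R $ j" "\<And>j. R $ j \<le> R' $ j"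
  shows "R \<in> capacity_region A C"
proof -
  define S where "S = {R. (\<forall>j. 0 \<le> R $ j) \<and> achievable A R C}"
  obtain X where X: "\<And>n. X n \<in> S" "X \<longlonglongrightarrow> R'"
    using R' unfolding capacity_region_def S_def[symmetric] closure_sequential by blast
  have "(\<chi> j. min (R $ j) (X n $ j)) \<in> S" for n
  proof -
    have X_n: "\<And>j. 0 \<le> X n $ j" "achievable A (X n) C"
      using X(1)[of n] by (auto simp: S_def)
    then have "achievable A (\<chi> j. min (R $ j) (X n $ j)) C"
      unfolding achievable_def by (simp add: min_le_iff_disj) blast
    then show ?thesis using X_n assms(2) by (simp add: S_def)
  qed
  moreover have "(\<lambda>n. \<chi> j. min (R $ j) (X n $ j)) \<longlonglongrightarrow> (\<chi> j. min (R $ j) (R' $ j))"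
    by (intro tendsto_intros tendsto_vec_nth X)
  moreover have "(\<chi> j. min (R $ j) (R' $ j)) = R"
    using assms(3) by (simp add: vec_eq_iff min_absorb1)
  ultimately have "R \<in> closure S"
    unfolding closure_sequential by (intro exI[of _ "\<lambda>n. \<chi> j. min (R $ j) (X n $ j)"]) simp
  then show ?thesis
    by (simp add: capacity_region_def S_def)
qed

subsection \<open>Outer bounds\<close>

text \<open>An injection between sets of sizes \<open>2 ^ (sum of t)\<close> and
  \<open>2 ^ (sum of w)\<close> compares the exponents. The index type of \<open>f\<close> is
  arbitrary, so one server may be counted for two realizations.\<close>

lemma counting_bound:
  fixes f :: "('n \<Rightarrow> bool list) \<Rightarrow> 'i \<Rightarrow> bool list"
  assumes "finite K" "finite I"
    and len: "\<And>z i. z \<in> (\<Pi>\<^sub>E j\<in>K. {l. length l = t j}) \<Longrightarrow> i \<in> I \<Longrightarrow> length (f z i) = w i"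
    and inj: "\<And>z z'. z \<in> (\<Pi>\<^sub>E j\<in>K. {l. length l = t j}) \<Longrightarrow>
      z' \<in> (\<Pi>\<^sub>E j\<in>K. {l. length l = t j}) \<Longrightarrow> (\<And>i. i \<in> I \<Longrightarrow> f z i = f z' i) \<Longrightarrow> z = z'"
  shows "(\<Sum>j\<in>K. t j) \<le> (\<Sum>i\<in>I. w i)"
proof -
  let ?Z = "\<Pi>\<^sub>E j\<in>K. {l :: bool list. length l = t j}"
  let ?W = "\<Pi>\<^sub>E i\<in>I. {l :: bool list. length l = w i}"
  have lists: "finite {l :: bool list. length l = m}" "card {l :: bool list. length l = m} = 2 ^ m" for m
    using finite_lists_length_eq[of "UNIV :: bool set" m] card_lists_length_eq[of "UNIV :: bool set" m]
    by simp_all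
  have "card ?Z \<le> card ?W"
  proof (rule card_inj_on_le)
    show "inj_on (\<lambda>z. restrict (f z) I) ?Z"
    proof (rule inj_onI)
      fix z z' assume z: "z \<in> ?Z" "z' \<in> ?Z" and eq: "restrict (f z) I = restrict (f z') I"
      show "z = z'"
        by (rule inj[OF z]) (metis eq restrict_apply')
    qed
    show "(\<lambda>z. restrict (f z) I) ` ?Z \<subseteq> ?W"
      using len by auto
    show "finite ?W"
      using assms(2) lists by (intro finite_PiE)
  qed
  then have "(2::nat) ^ (\<Sum>j\<in>K. t j) \<le> 2 ^ (\<Sum>i\<in>I. w i)"
    using assms(1,2) by (simp add: card_PiE lists power_sum)
  then show ?thesis by simp
qed

text \<open>Zero strings of the right lengths complete a tuple over \<open>K\<close> to a full
  realization and make all side information outside \<open>K\<close> constant.\<close>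

definition zero_fill :: "('n \<Rightarrow> nat) \<Rightarrow> 'n set \<Rightarrow> ('n \<Rightarrow> bool list) \<Rightarrow> 'n \<Rightarrow> bool list" where
  "zero_fill t K z j = (if j \<in> K then z j else replicate (t j) False)"

lemma zero_fill_messages:
  "(\<And>j. j \<in> K \<Longrightarrow> length (z j) = t j) \<Longrightarrow> zero_fill t K z \<in> messages t"
  by (auto simp: messages_def zero_fill_def)

text \<open>The rank is a topological order of the side information on \<open>K\<close>. With the
  messages outside \<open>K\<close> zeroed, servers missing \<open>K\<close> send constants, and the
  broadcast of the others yields the messages in \<open>K\<close> one after another.\<close>

lemma codable_acyclic_bound:
  fixes A :: "'n::finite \<Rightarrow> 'n set" and rank :: "'n \<Rightarrow> nat"
  assumes "codable A t u"
    and rank: "\<And>i j. j \<in> K \<Longrightarrow> i \<in> K \<Longrightarrow> i \<in> A j \<Longrightarrow> rank i < rank j"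
  shows "(\<Sum>j\<in>K. t j) \<le> (\<Sum>J | J \<inter> K \<noteq> {}. u J)"
proof -
  obtain enc where enc: "encodes A t u enc"
    using assms(1) unfolding codable_def by blast
  let ?x = "zero_fill t K"
  show ?thesis
  proof (rule counting_bound[where f = "\<lambda>z J. enc J (restrict (?x z) J)"])
    fix z :: "'n \<Rightarrow> bool list" and J
    assume z: "z \<in> (\<Pi>\<^sub>E j\<in>K. {l. length l = t j})" and J: "J \<in> {J. J \<inter> K \<noteq> {}}"
    have "?x z \<in> messages t"
      using PiE_mem[OF z] by (simp add: zero_fill_messages)
    then show "length (enc J (restrict (?x z) J)) = u J"
      using J by (auto intro!: encodes_length[OF enc] simp: servers_def)
  next
    fix z z' :: "'n \<Rightarrow> bool list"
    assume z: "z \<in> (\<Pi>\<^sub>E j\<in>K. {l. length l = t j})" "z' \<in> (\<Pi>\<^sub>E j\<in>K. {l. length l = t j})"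
      and eq: "\<And>J. J \<in> {J. J \<inter> K \<noteq> {}} \<Longrightarrow> enc J (restrict (?x z) J) = enc J (restrict (?x z') J)"
    have all: "enc J (restrict (?x z) J) = enc J (restrict (?x z') J)" for J
    proof (cases "J \<inter> K = {}")
      case True
      then have "restrict (?x z) J = restrict (?x z') J"
        by (auto simp: zero_fill_def intro!: restrict_ext)
      then show ?thesis by simp
    qed (use eq in auto)
    have lens: "length (z l) = t l" "length (z' l) = t l" if "l \<in> K" for l
      using PiE_mem[OF z(1) that] PiE_mem[OF z(2) that] by simp_all
    have mem: "?x z \<in> messages t" "?x z' \<in> messages t"
      by (auto intro!: zero_fill_messages lens)
    \<comment> \<open>Side information inside \<open>K\<close> has smaller rank, so the induction
      covers it; outside \<open>K\<close> both tuples are zero.\<close>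
    have filled: "?x z j = ?x z' j" for j
    proof (induction "rank j" arbitrary: j rule: less_induct)
      case less
      show ?case
      proof (cases "j \<in> K")
        case True
        have "?x z i = ?x z' i" if "i \<in> A j" for i
        proof (cases "i \<in> K")
          case iK: True
          show ?thesis by (rule less[OF rank[OF True iK that]])
        qed (simp add: zero_fill_def)
        with all show ?thesis by (rule encodes_separates[OF enc mem])
      qed (simp add: zero_fill_def)
    qed
    show "z = z'"
    proof (rule PiE_ext[OF z])
      show "z j = z' j" if "j \<in> K" for j
        using filled[of j] that by (simp add: zero_fill_def)
    qed
  qed auto
qed

text \<open>
  The broadcast determines \<open>x\<^sub>i\<close>. The only further symbols needed to know the whole broadcast for
  the messages with \<open>x\<^sub>j\<close> zeroed are those of servers holding both \<open>j\<close> and \<open>k\<close>; they give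
  \<open>x\<^sub>k\<close>, and then the original broadcast gives \<open>x\<^sub>j\<close>.
\<close>

lemma codable_triple_bound:
  fixes A :: "'n::finite \<Rightarrow> 'n set"
  assumes "codable A t u" and dist: "i \<noteq> j" "i \<noteq> k" "j \<noteq> k"
    and side: "A i \<inter> {i, j, k} = {}" "j \<notin> A j" "k \<notin> A k"
  shows "t i + t j + t k \<le> (\<Sum>J | J \<inter> {i, j, k} \<noteq> {}. u J) + (\<Sum>J | {j, k} \<subseteq> J. u J)"
proof -
  obtain enc where enc: "encodes A t u enc"
    using assms(1) unfolding codable_def by blast
  let ?K = "{i, j, k}"
  let ?x = "zero_fill t ?K" and ?x' = "zero_fill t {i, k}"
  \<comment> \<open>A server holding both \<open>j\<close> and \<open>k\<close> occurs twice: under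
    \<open>Inl\<close> with the true message \<open>j\<close>, under \<open>Inr\<close> with that
    message zeroed.\<close>
  let ?I = "Inl ` {J. J \<inter> ?K \<noteq> {}} \<union> Inr ` {J. {j, k} \<subseteq> J} :: ('n set + 'n set) set"
  have "(\<Sum>l\<in>?K. t l) \<le> (\<Sum>s\<in>?I. case_sum u u s)"
  proof (rule counting_bound[where f = "\<lambda>z. case_sum (\<lambda>J. enc J (restrict (?x z) J))
        (\<lambda>J. enc J (restrict (?x' z) J))"])
    fix z :: "'n \<Rightarrow> bool list" and s assume z: "z \<in> (\<Pi>\<^sub>E j\<in>?K. {l. length l = t j})" and s: "s \<in> ?I"
    have "?x z \<in> messages t" "?x' z \<in> messages t"
      using PiE_mem[OF z] by (auto intro!: zero_fill_messages)
    then show "length (case_sum (\<lambda>J. enc J (restrict (?x z) J))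
        (\<lambda>J. enc J (restrict (?x' z) J)) s) = case_sum u u s"
      using s by (auto intro!: encodes_length[OF enc] simp: servers_def)
  next
    fix z z' :: "'n \<Rightarrow> bool list"
    assume z: "z \<in> (\<Pi>\<^sub>E j\<in>?K. {l. length l = t j})" "z' \<in> (\<Pi>\<^sub>E j\<in>?K. {l. length l = t j})"
      and same: "\<And>s. s \<in> ?I \<Longrightarrow>
        case_sum (\<lambda>J. enc J (restrict (?x z) J)) (\<lambda>J. enc J (restrict (?x' z) J)) s =
        case_sum (\<lambda>J. enc J (restrict (?x z') J)) (\<lambda>J. enc J (restrict (?x' z') J)) s"
    have eq: "enc J (restrict (?x z) J) = enc J (restrict (?x z') J)" if "J \<inter> ?K \<noteq> {}" for J
      using same[of "Inl J"] that by auto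
    have eq': "enc J (restrict (?x' z) J) = enc J (restrict (?x' z') J)" if "{j, k} \<subseteq> J" for J
      using same[of "Inr J"] that by auto
    have lens: "length (z l) = t l" "length (z' l) = t l" if "l \<in> ?K" for l
      using PiE_mem[OF z(1) that] PiE_mem[OF z(2) that] by simp_all
    have mem: "?x z \<in> messages t" "?x z' \<in> messages t" "?x' z \<in> messages t" "?x' z' \<in> messages t"
      by (auto intro!: zero_fill_messages lens)
    have all: "enc J (restrict (?x z) J) = enc J (restrict (?x z') J)" for J
    proof (cases "J \<inter> ?K = {}")
      case True
      then have "restrict (?x z) J = restrict (?x z') J"
        by (intro restrict_ext) (auto simp: zero_fill_def)
      then show ?thesis by simp
    qed (use eq in auto)
    have "?x z i = ?x z' i"
      by (rule encodes_separates[OF enc mem(1,2) all]) (use side in \<open>auto simp: zero_fill_def\<close>)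
    then have i: "z i = z' i" by (simp add: zero_fill_def)
    \<comment> \<open>A server without \<open>j\<close> does not notice the zeroing; a server
      without \<open>k\<close> sees, of the three, only message \<open>i\<close>, already
      determined, and a zero.\<close>
    have all': "enc J (restrict (?x' z) J) = enc J (restrict (?x' z') J)" for J
    proof -
      consider "{j, k} \<subseteq> J" | "j \<notin> J" | "k \<notin> J" by blast
      then show ?thesis
      proof cases
        case 1
        then show ?thesis by (rule eq')
      next
        case 2
        then have "restrict (?x' y) J = restrict (?x y) J" for y
          by (intro restrict_ext) (auto simp: zero_fill_def)
        then show ?thesis using all by simp
      next
        case 3
        then have "restrict (?x' z) J = restrict (?x' z') J"
          using i by (intro restrict_ext) (auto simp: zero_fill_def)
        then show ?thesis by simp
      qed
    qed
    have "?x' z k = ?x' z' k"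
      by (rule encodes_separates[OF enc mem(3,4) all']) (use side i in \<open>auto simp: zero_fill_def\<close>)
    then have k: "z k = z' k" by (simp add: zero_fill_def)
    have "?x z j = ?x z' j"
      by (rule encodes_separates[OF enc mem(1,2) all]) (use side i k in \<open>auto simp: zero_fill_def\<close>)
    then have "z j = z' j" by (simp add: zero_fill_def)
    with i k show "z = z'"
      by (intro PiE_ext[OF z]) auto
  qed auto
  also have "\<dots> = (\<Sum>J | J \<inter> ?K \<noteq> {}. u J) + (\<Sum>J | {j, k} \<subseteq> J. u J)"
    by (subst sum.union_disjoint) (auto simp: sum.reindex)
  finally show ?thesis using dist by (simp add: add.assoc)
qed

lemma achievable_acyclic_bound:
  fixes A :: "'n::finite \<Rightarrow> 'n set" and rank :: "'n \<Rightarrow> nat"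
  assumes "achievable A R C"
    and "\<And>i j. j \<in> K \<Longrightarrow> i \<in> K \<Longrightarrow> i \<in> A j \<Longrightarrow> rank i < rank j"
  shows "(\<Sum>j\<in>K. R $ j) \<le> (\<Sum>J | J \<inter> K \<noteq> {}. C J)"
proof -
  obtain t u r where c: "codable A t u" and r: "r > 0" and
    R: "\<And>j. R $ j \<le> real (t j) / r" and C: "\<And>J. J \<in> servers \<Longrightarrow> real (u J) / r \<le> C J"
    using assms(1) unfolding achievable_iff_codable by blast
  have "(\<Sum>j\<in>K. R $ j) \<le> real (\<Sum>j\<in>K. t j) / r"
    unfolding of_nat_sum sum_divide_distrib by (intro sum_mono R)
  also have "\<dots> \<le> real (\<Sum>J | J \<inter> K \<noteq> {}. u J) / r"
    using codable_acyclic_bound[OF c assms(2)] r by (intro divide_right_mono of_nat_mono) auto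
  also have "\<dots> \<le> (\<Sum>J | J \<inter> K \<noteq> {}. C J)"
    unfolding of_nat_sum sum_divide_distrib by (intro sum_mono C) (auto simp: servers_def)
  finally show ?thesis .
qed

lemma achievable_triple_bound:
  fixes A :: "'n::finite \<Rightarrow> 'n set"
  assumes "achievable A R C" "i \<noteq> j" "i \<noteq> k" "j \<noteq> k"
    and "A i \<inter> {i, j, k} = {}" "j \<notin> A j" "k \<notin> A k"
  shows "R $ i + R $ j + R $ k \<le> (\<Sum>J | J \<inter> {i, j, k} \<noteq> {}. C J) + (\<Sum>J | {j, k} \<subseteq> J. C J)"
proof -
  obtain t u r where c: "codable A t u" and r: "r > 0" and
    R: "\<And>j. R $ j \<le> real (t j) / r" and C: "\<And>J. J \<in> servers \<Longrightarrow> real (u J) / r \<le> C J"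
    using assms(1) unfolding achievable_iff_codable by blast
  have "R $ i + R $ j + R $ k \<le> real (t i + t j + t k) / r"
    using R[of i] R[of j] R[of k] by (simp add: add_divide_distrib)
  also have "\<dots> \<le> real ((\<Sum>J | J \<inter> {i, j, k} \<noteq> {}. u J) + (\<Sum>J | {j, k} \<subseteq> J. u J)) / r"
    using codable_triple_bound[OF c assms(2-7)] r by (intro divide_right_mono of_nat_mono) auto
  also have "\<dots> \<le> (\<Sum>J | J \<inter> {i, j, k} \<noteq> {}. C J) + (\<Sum>J | {j, k} \<subseteq> J. C J)"
    unfolding of_nat_sum of_nat_add add_divide_distrib sum_divide_distrib
    by (intro add_mono sum_mono C) (auto simp: servers_def)
  finally show ?thesis .
qed

subsection \<open>Achievable rates for three messages\<close>

text \<open>Syntax for the elementary codes, servers first. A scheme becomes a list whose validity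
  and rates are settled by simplification.\<close>

datatype 'n piece = Clique "'n set" "'n set" | Two_Sums "'n set" "'n set" 'n 'n 'n

fun piece_servers :: "'n piece \<Rightarrow> 'n set set" where
  "piece_servers (Clique J K) = {J}"
| "piece_servers (Two_Sums J J' i j k) = {J, J'}"

fun piece_rate :: "'n piece \<Rightarrow> 'n \<Rightarrow> nat" where
  "piece_rate (Clique J K) l = of_bool (l \<in> K)"
| "piece_rate (Two_Sums J J' i j k) l = of_bool (l \<in> {i, j, k})"

fun piece_valid :: "('n \<Rightarrow> 'n set) \<Rightarrow> 'n piece \<Rightarrow> bool" where
  "piece_valid A (Clique J K) \<longleftrightarrow> J \<noteq> {} \<and> K \<subseteq> J \<and> (\<forall>j\<in>K. \<forall>i\<in>K. i = j \<or> i \<in> A j)"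
| "piece_valid A (Two_Sums J J' i j k) \<longleftrightarrow>
     i \<noteq> j \<and> i \<noteq> k \<and> j \<noteq> k \<and> i \<in> J \<and> j \<in> J \<and> j \<in> J' \<and> k \<in> J' \<and> J \<noteq> J' \<and>
     (j \<in> A i \<or> k \<in> A i) \<and> (i \<in> A j \<or> k \<in> A j) \<and> (i \<in> A k \<or> j \<in> A k)"

lemma codable_piece:
  fixes A :: "'n::finite \<Rightarrow> 'n set"
  assumes "piece_valid A p"
  shows "codable A (piece_rate p) (\<lambda>J. of_bool (J \<in> piece_servers p))"
proof (cases p)
  case (Clique J K)
  then have "codable A (\<lambda>j. of_bool (j \<in> K)) (\<lambda>J'. of_bool (J' = J))"
    using assms by (intro codable_clique) auto
  moreover have "piece_rate p = (\<lambda>j. of_bool (j \<in> K))"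
    using Clique by (simp add: fun_eq_iff)
  ultimately show ?thesis
    using Clique by simp
next
  case (Two_Sums J J' i j k)
  then have "codable A (\<lambda>l. of_bool (l \<in> {i, j, k})) (\<lambda>L. of_bool (L = J) + of_bool (L = J'))"
    using assms by (intro codable_two_sums) auto
  moreover have "piece_rate p = (\<lambda>l. of_bool (l \<in> {i, j, k}))"
    using Two_Sums by (simp add: fun_eq_iff)
  moreover have "(\<lambda>L. of_bool (L \<in> piece_servers p) :: nat) = (\<lambda>L. of_bool (L = J) + of_bool (L = J'))"
    using Two_Sums assms by (auto simp: fun_eq_iff)
  ultimately show ?thesis by simp
qed

text \<open>Since the pieces use disjoint sets of servers, running them side by side still costs
  each server at most one bit.\<close>

lemma codable_pieces:
  fixes A :: "'n::finite \<Rightarrow> 'n set"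
  assumes "list_all (piece_valid A) ps" "sorted_wrt (\<lambda>p q. piece_servers p \<inter> piece_servers q = {}) ps"
  shows "codable A (\<lambda>j. \<Sum>p\<leftarrow>ps. piece_rate p j) (\<lambda>J. of_bool (\<exists>p\<in>set ps. J \<in> piece_servers p))"
  using assms
proof (induction ps)
  case Nil
  then show ?case using codable_zero by simp
next
  case (Cons p ps)
  have "codable A (\<lambda>j. piece_rate p j + (\<Sum>p\<leftarrow>ps. piece_rate p j))
      (\<lambda>J. of_bool (J \<in> piece_servers p) + of_bool (\<exists>p\<in>set ps. J \<in> piece_servers p))"
    using Cons by (intro codable_add) (auto intro: codable_piece)
  moreover have "(\<lambda>J. of_bool (\<exists>q\<in>set (p # ps). J \<in> piece_servers q) :: nat) =
      (\<lambda>J. of_bool (J \<in> piece_servers p) + of_bool (\<exists>p\<in>set ps. J \<in> piece_servers p))"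
    using Cons.prems by (fastforce simp: fun_eq_iff)
  ultimately show ?case by simp
qed

lemma pieces_in_capacity_region:
  fixes A :: "3 \<Rightarrow> 3 set"
  assumes C: "\<forall>J\<in>servers. C J = 1"
    and "list_all (piece_valid A) ps" "sorted_wrt (\<lambda>p q. piece_servers p \<inter> piece_servers q = {}) ps"
    and R: "(\<Sum>p\<leftarrow>ps. real (piece_rate p 1)) = a" "(\<Sum>p\<leftarrow>ps. real (piece_rate p 2)) = b"
      "(\<Sum>p\<leftarrow>ps. real (piece_rate p 3)) = c"
  shows "vector [a, b, c] \<in> capacity_region A C"
proof -
  have sum: "real (\<Sum>p\<leftarrow>ps. piece_rate p j) = (\<Sum>p\<leftarrow>ps. real (piece_rate p j))" for j
    by (induction ps) auto
  have R': "vector [a, b, c] $ j = (\<Sum>p\<leftarrow>ps. real (piece_rate p j))" for j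
    using exhaust_3[of j] R by auto
  have "achievable A (vector [a, b, c]) C"
    unfolding achievable_iff_codable
    using codable_pieces[OF assms(2,3)]  C
    by (intro exI[of _ "\<lambda>j. \<Sum>p\<leftarrow>ps. piece_rate p j"]
        exI[of _ "\<lambda>J. of_bool (\<exists>p\<in>set ps. J \<in> piece_servers p)"] exI[of _ "1 :: real"])
      (simp add: R' sum)
  moreover have "0 \<le> vector [a, b, c] $ (j :: 3)" for j
    unfolding R' by (intro sum_list_nonneg) auto
  ultimately show ?thesis
    unfolding capacity_region_def by (intro subsetD[OF closure_subset]) simp
qed

section \<open>Mixtures of rate triples\<close>

text \<open>The segment from \<open>(p, q)\<close> to \<open>(q, p)\<close> is the part of the line
  with coordinate sum \<open>p + q\<close> on which both coordinates are at most \<open>p\<close>;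
  it dominates whatever lies below. Planar slices of the regions are handled this way.\<close>

lemma dominated_by_swap_mixture:
  fixes p q x y :: real
  assumes "q \<le> p" "x \<le> p" "y \<le> p" "x + y \<le> p + q"
  shows "\<exists>s. 0 \<le> s \<and> s \<le> 1 \<and> x \<le> (1 - s) * p + s * q \<and> y \<le> (1 - s) * q + s * p"
proof (cases "x \<le> q")
  case True
  then show ?thesis using assms by (intro exI[of _ 1]) auto
next
  case False
  \<comment> \<open>This \<open>s\<close> makes the first coordinate exactly \<open>x\<close>; the
    second is then \<open>p + q - x\<close>, which is at least \<open>y\<close>.\<close>
  define s where "s = (p - x) / (p - q)"
  have "s * (p - q) = p - x"
    using False assms by (simp add: s_def)
  moreover have "0 \<le> s" "s \<le> 1"
    using False assms by (auto simp: s_def)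
  ultimately show ?thesis
    using assms by (intro exI[of _ s]) (simp add: algebra_simps)
qed

lemma capacity_region_mix:
  fixes A :: "3 \<Rightarrow> 3 set"
  assumes "vector [a, b, c] \<in> capacity_region A C" "vector [a', b', c'] \<in> capacity_region A C"
    and "0 \<le> s" "s \<le> 1" "0 \<le> x" "0 \<le> y" "0 \<le> z"
    and le: "x \<le> (1 - s) * a + s * a'" "y \<le> (1 - s) * b + s * b'" "z \<le> (1 - s) * c + s * c'"
  shows "vector [x, y, z] \<in> capacity_region A C"
proof (rule capacity_region_downward)
  show "(1 - s) *\<^sub>R vector [a, b, c] + s *\<^sub>R vector [a', b', c'] \<in> capacity_region A C"
    using assms by (intro convexD[OF convex_capacity_region]) auto
  fix j :: 3
  show "0 \<le> vector [x, y, z] $ j"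
    and "vector [x, y, z] $ j \<le> ((1 - s) *\<^sub>R vector [a, b, c] + s *\<^sub>R vector [a', b', c']) $ j"
    using exhaust_3[of j] assms by auto
qed

text \<open>\<open>distinct\<close> gives each inequality in one orientation only; the reversed list
  supplies the other, so that rewriting succeeds in both.\<close>

lemma distinct_servers3:
  "distinct [{1}, {2}, {3}, {1, 2}, {1, 3}, {2, 3}, {1, 2, 3} :: 3 set]"
  "distinct [{1, 2, 3}, {2, 3}, {1, 3}, {1, 2}, {3}, {2}, {1} :: 3 set]"
  by (simp_all add: set_eq_iff forall_3)

lemmas servers3_neq = 
  distinct_servers3[unfolded distinct.simps list.set insert_iff empty_iff de_Morgan_disj simp_thms]

section \<open>Integer rate triples with one bit per server\<close>

text \<open>Uncoded sending by priority: message \<open>1\<close> takes all four servers holding it,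
  message \<open>2\<close> the two left to it, message \<open>3\<close> the last. The other priority
  orders give the permuted triples.\<close>

lemma rate_421:
  fixes A :: "3 \<Rightarrow> 3 set"
  assumes C: "\<forall>J\<in>servers. C J = 1"
  shows "vector [4, 2, 1] \<in> capacity_region A C"
  by (rule pieces_in_capacity_region[OF C, where ps =
        "[Clique {1} {1}, Clique {2} {2}, Clique {3} {3}, Clique {1, 2} {1}, Clique {1, 3}
          {1}, Clique {2, 3} {2}, Clique {1, 2, 3} {1}]"])
    (use assms in \<open>simp_all add: servers3_neq\<close>)

lemma rate_412:
  fixes A :: "3 \<Rightarrow> 3 set"
  assumes C: "\<forall>J\<in>servers. C J = 1"
  shows "vector [4, 1, 2] \<in> capacity_region A C"
  by (rule pieces_in_capacity_region[OF C, where ps =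
        "[Clique {1} {1}, Clique {2} {2}, Clique {3} {3}, Clique {1, 2} {1}, Clique {1, 3}
          {1}, Clique {2, 3} {3}, Clique {1, 2, 3} {1}]"])
    (use assms in \<open>simp_all add: servers3_neq\<close>)

lemma rate_241:
  fixes A :: "3 \<Rightarrow> 3 set"
  assumes C: "\<forall>J\<in>servers. C J = 1"
  shows "vector [2, 4, 1] \<in> capacity_region A C"
  by (rule pieces_in_capacity_region[OF C, where ps =
        "[Clique {1} {1}, Clique {2} {2}, Clique {3} {3}, Clique {1, 2} {2}, Clique {1, 3}
          {1}, Clique {2, 3} {2}, Clique {1, 2, 3} {2}]"])
    (use assms in \<open>simp_all add: servers3_neq\<close>)

lemma rate_142:
  fixes A :: "3 \<Rightarrow> 3 set"
  assumes C: "\<forall>J\<in>servers. C J = 1"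
  shows "vector [1, 4, 2] \<in> capacity_region A C"
  by (rule pieces_in_capacity_region[OF C, where ps =
        "[Clique {1} {1}, Clique {2} {2}, Clique {3} {3}, Clique {1, 2} {2}, Clique {1, 3}
          {3}, Clique {2, 3} {2}, Clique {1, 2, 3} {2}]"])
    (use assms in \<open>simp_all add: servers3_neq\<close>)

lemma rate_214:
  fixes A :: "3 \<Rightarrow> 3 set"
  assumes C: "\<forall>J\<in>servers. C J = 1"
  shows "vector [2, 1, 4] \<in> capacity_region A C"
  by (rule pieces_in_capacity_region[OF C, where ps =
        "[Clique {1} {1}, Clique {2} {2}, Clique {3} {3}, Clique {1, 2} {1}, Clique {1, 3}
          {3}, Clique {2, 3} {3}, Clique {1, 2, 3} {3}]"])
    (use assms in \<open>simp_all add: servers3_neq\<close>)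

lemma rate_124:
  fixes A :: "3 \<Rightarrow> 3 set"
  assumes C: "\<forall>J\<in>servers. C J = 1"
  shows "vector [1, 2, 4] \<in> capacity_region A C"
  by (rule pieces_in_capacity_region[OF C, where ps =
        "[Clique {1} {1}, Clique {2} {2}, Clique {3} {3}, Clique {1, 2} {2}, Clique {1, 3}
          {3}, Clique {2, 3} {3}, Clique {1, 2, 3} {3}]"])
    (use assms in \<open>simp_all add: servers3_neq\<close>)

text \<open>On a directed cycle of side information each pair of sums serves three receivers with
  two bits, so seven servers deliver nine bits.\<close>

lemma rate_333_cycle:
  fixes A :: "3 \<Rightarrow> 3 set"
  assumes C: "\<forall>J\<in>servers. C J = 1"
    and "3 \<in> A 1" "1 \<in> A 2" "2 \<in> A 3"
  shows "vector [3, 3, 3] \<in> capacity_region A C"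
  by (rule pieces_in_capacity_region[OF C, where ps =
        "[Clique {1} {1}, Clique {2} {2}, Clique {3} {3}, Two_Sums {1, 2} {2, 3} 1 2 3,
          Two_Sums {1, 3} {1, 2, 3} 3 1 2]"])
    (use assms in \<open>simp_all add: servers3_neq\<close>)

lemma rate_422_cycle:
  fixes A :: "3 \<Rightarrow> 3 set"
  assumes C: "\<forall>J\<in>servers. C J = 1"
    and "3 \<in> A 1" "1 \<in> A 2" "2 \<in> A 3"
  shows "vector [4, 2, 2] \<in> capacity_region A C"
  by (rule pieces_in_capacity_region[OF C, where ps =
        "[Clique {1} {1}, Clique {2} {2}, Clique {3} {3}, Clique {1, 2} {1}, Clique {1, 3}
          {1}, Two_Sums {2, 3} {1, 2, 3} 3 2 1]"])
    (use assms in \<open>simp_all add: servers3_neq\<close>)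

lemma rate_242_cycle:
  fixes A :: "3 \<Rightarrow> 3 set"
  assumes C: "\<forall>J\<in>servers. C J = 1"
    and "3 \<in> A 1" "1 \<in> A 2" "2 \<in> A 3"
  shows "vector [2, 4, 2] \<in> capacity_region A C"
  by (rule pieces_in_capacity_region[OF C, where ps =
        "[Clique {1} {1}, Clique {2} {2}, Clique {3} {3}, Clique {1, 2} {2}, Clique {2, 3}
          {2}, Two_Sums {1, 3} {1, 2, 3} 1 3 2]"])
    (use assms in \<open>simp_all add: servers3_neq\<close>)

lemma rate_224_cycle:
  fixes A :: "3 \<Rightarrow> 3 set"
  assumes C: "\<forall>J\<in>servers. C J = 1"
    and "3 \<in> A 1" "1 \<in> A 2" "2 \<in> A 3"
  shows "vector [2, 2, 4] \<in> capacity_region A C"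
  by (rule pieces_in_capacity_region[OF C, where ps =
        "[Clique {1} {1}, Clique {2} {2}, Clique {3} {3}, Clique {1, 3} {3}, Clique {2, 3}
          {3}, Two_Sums {1, 2} {1, 2, 3} 1 2 3]"])
    (use assms in \<open>simp_all add: servers3_neq\<close>)

text \<open>Receivers \<open>2\<close> and \<open>3\<close> know each other's message, so a server
  holding both messages can serve both receivers with one bit.\<close>

lemma rate_422:
  fixes A :: "3 \<Rightarrow> 3 set"
  assumes C: "\<forall>J\<in>servers. C J = 1"
    and "3 \<in> A 2" "2 \<in> A 3"
  shows "vector [4, 2, 2] \<in> capacity_region A C"
  by (rule pieces_in_capacity_region[OF C, where ps =
        "[Clique {1} {1}, Clique {2} {2}, Clique {3} {3}, Clique {1, 2} {1}, Clique {1, 3}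
          {1}, Clique {2, 3} {2, 3}, Clique {1, 2, 3} {1}]"])
    (use assms in \<open>simp_all add: servers3_neq\<close>)

lemma rate_144:
  fixes A :: "3 \<Rightarrow> 3 set"
  assumes C: "\<forall>J\<in>servers. C J = 1"
    and "3 \<in> A 2" "2 \<in> A 3"
  shows "vector [1, 4, 4] \<in> capacity_region A C"
  by (rule pieces_in_capacity_region[OF C, where ps =
        "[Clique {1} {1}, Clique {2} {2}, Clique {3} {3}, Clique {1, 2} {2}, Clique {1, 3}
          {3}, Clique {2, 3} {2, 3}, Clique {1, 2, 3} {2, 3}]"])
    (use assms in \<open>simp_all add: servers3_neq\<close>)

lemma rate_243:
  fixes A :: "3 \<Rightarrow> 3 set"
  assumes C: "\<forall>J\<in>servers. C J = 1"
    and "3 \<in> A 2" "2 \<in> A 3"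
  shows "vector [2, 4, 3] \<in> capacity_region A C"
  by (rule pieces_in_capacity_region[OF C, where ps =
        "[Clique {1} {1}, Clique {2} {2}, Clique {3} {3}, Clique {1, 2} {2}, Clique {1, 3}
          {1}, Clique {2, 3} {2, 3}, Clique {1, 2, 3} {2, 3}]"])
    (use assms in \<open>simp_all add: servers3_neq\<close>)

lemma rate_234:
  fixes A :: "3 \<Rightarrow> 3 set"
  assumes C: "\<forall>J\<in>servers. C J = 1"
    and "3 \<in> A 2" "2 \<in> A 3"
  shows "vector [2, 3, 4] \<in> capacity_region A C"
  by (rule pieces_in_capacity_region[OF C, where ps =
        "[Clique {1} {1}, Clique {2} {2}, Clique {3} {3}, Clique {1, 2} {1}, Clique {1, 3}
          {3}, Clique {2, 3} {2, 3}, Clique {1, 2, 3} {2, 3}]"])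
    (use assms in \<open>simp_all add: servers3_neq\<close>)

lemma rate_333:
  fixes A :: "3 \<Rightarrow> 3 set"
  assumes C: "\<forall>J\<in>servers. C J = 1"
    and "3 \<in> A 2" "2 \<in> A 3"
  shows "vector [3, 3, 3] \<in> capacity_region A C"
  by (rule pieces_in_capacity_region[OF C, where ps =
        "[Clique {1} {1}, Clique {2} {2}, Clique {3} {3}, Clique {1, 2} {1}, Clique {1, 3}
          {1}, Clique {2, 3} {2, 3}, Clique {1, 2, 3} {2, 3}]"])
    (use assms in \<open>simp_all add: servers3_neq\<close>)

text \<open>Neither \<open>{1, 2}\<close> nor \<open>{1, 3}\<close> holds both \<open>2\<close> and
  \<open>3\<close>, yet their sums through message \<open>1\<close> serve all three receivers. This
  gains the tenth bit, which is out of reach in (iii).\<close>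

lemma rate_244:
  fixes A :: "3 \<Rightarrow> 3 set"
  assumes C: "\<forall>J\<in>servers. C J = 1"
    and "3 \<in> A 1" "3 \<in> A 2" "2 \<in> A 3"
  shows "vector [2, 4, 4] \<in> capacity_region A C"
  by (rule pieces_in_capacity_region[OF C, where ps =
        "[Clique {1} {1}, Clique {2} {2}, Clique {3} {3}, Clique {2, 3} {2, 3}, Clique {1, 2,
          3} {2, 3}, Two_Sums {1, 2} {1, 3} 2 1 3]"])
    (use assms in \<open>simp_all add: servers3_neq\<close>)

lemma rate_424:
  fixes A :: "3 \<Rightarrow> 3 set"
  assumes C: "\<forall>J\<in>servers. C J = 1"
    and "3 \<in> A 1" "1 \<in> A 3" "3 \<in> A 2" "2 \<in> A 3"
  shows "vector [4, 2, 4] \<in> capacity_region A C"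
  by (rule pieces_in_capacity_region[OF C, where ps =
        "[Clique {1} {1}, Clique {2} {2}, Clique {3} {3}, Clique {1, 2} {1}, Clique {1, 3} {1,
          3}, Clique {2, 3} {2, 3}, Clique {1, 2, 3} {1, 3}]"])
    (use assms in \<open>simp_all add: servers3_neq\<close>)

lemma rate_444:
  fixes A :: "3 \<Rightarrow> 3 set"
  assumes C: "\<forall>J\<in>servers. C J = 1"
    and "2 \<in> A 1" "1 \<in> A 2" "3 \<in> A 1" "1 \<in> A 3" "3 \<in> A 2" "2 \<in> A 3"
  shows "vector [4, 4, 4] \<in> capacity_region A C"
  by (rule pieces_in_capacity_region[OF C, where ps =
        "[Clique {1} {1}, Clique {2} {2}, Clique {3} {3}, Clique {1, 2} {1, 2}, Clique {1, 3}
          {1, 3}, Clique {2, 3} {2, 3}, Clique {1, 2, 3} {1, 2, 3}]"])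
    (use assms in \<open>simp_all add: servers3_neq\<close>)

section \<open>Inner bounds for the six regions\<close>

lemma rate_region_subsetI:
  assumes "\<And>x y z. vector [x, y, z] \<in> rate_region b12 b13 b23 b123 \<Longrightarrow> vector [x, y, z] \<in> S"
  shows "rate_region b12 b13 b23 b123 \<subseteq> S"
proof
  fix R :: "real ^ 3" assume "R \<in> rate_region b12 b13 b23 b123"
  moreover have "R = vector [R $ 1, R $ 2, R $ 3]"
    by (simp add: vec_eq_iff forall_3)
  ultimately show "R \<in> S"
    using assms by metis
qed

lemma rate_region_i_subset:
  fixes A :: "3 \<Rightarrow> 3 set"
  assumes C: "\<forall>J\<in>servers. C J = 1"
  shows "rate_region 6 6 6 7 \<subseteq> capacity_region A C"
proof (rule rate_region_subsetI)
  fix x y z :: real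
  assume R: "vector [x, y, z] \<in> rate_region 6 6 6 7"
  note bounds = R[unfolded rate_region_def, simplified]
  \<comment> \<open>In the slice at height \<open>z\<close> the corners to reach are
    \<open>(4, 2)\<close>, then \<open>(4, 3 - z)\<close> once the bound \<open>7\<close> binds,
    then \<open>(6 - z, 1)\<close> once the pair bounds undercut the cap \<open>4\<close>, each with
    its mirror image. \<open>P\<close> and \<open>Q\<close> below lift them to mixtures of integer
    triples.\<close>
  consider "z \<le> 1" | "1 \<le> z" "z \<le> 2" | "2 \<le> z" by linarith
  then show "vector [x, y, z] \<in> capacity_region A C"
  proof cases
    case 1
    obtain s where s: "0 \<le> s" "s \<le> 1" "x \<le> (1 - s) * 4 + s * 2" "y \<le> (1 - s) * 2 + s * 4"
      using dominated_by_swap_mixture[of 2 4 x y] bounds by auto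
    show ?thesis
      by (rule capacity_region_mix[OF rate_421[OF C] rate_241[OF C] s(1,2)])
        (use bounds s 1 in auto)
  next
    case 2
    have P: "vector [4, 3 - z, z] \<in> capacity_region A C"
      by (rule capacity_region_mix[OF rate_421[OF C] rate_412[OF C], of "z - 1"])
        (use bounds 2 in auto)
    have Q: "vector [3 - z, 4, z] \<in> capacity_region A C"
      by (rule capacity_region_mix[OF rate_241[OF C] rate_142[OF C], of "z - 1"])
        (use bounds 2 in auto)
    obtain s where s: "0 \<le> s" "s \<le> 1"
        "x \<le> (1 - s) * 4 + s * (3 - z)" "y \<le> (1 - s) * (3 - z) + s * 4"
      using dominated_by_swap_mixture[of "3 - z" 4 x y] bounds 2 by auto
    show ?thesis
      by (rule capacity_region_mix[OF P Q s(1,2)]) (use bounds s in \<open>auto simp: algebra_simps\<close>)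
  next
    case 3
    have P: "vector [6 - z, 1, z] \<in> capacity_region A C"
      by (rule capacity_region_mix[OF rate_412[OF C] rate_214[OF C], of "(z - 2) / 2"])
        (use bounds 3 in \<open>auto simp: field_simps\<close>)
    have Q: "vector [1, 6 - z, z] \<in> capacity_region A C"
      by (rule capacity_region_mix[OF rate_142[OF C] rate_124[OF C], of "(z - 2) / 2"])
        (use bounds 3 in \<open>auto simp: field_simps\<close>)
    obtain s where s: "0 \<le> s" "s \<le> 1"
        "x \<le> (1 - s) * (6 - z) + s * 1" "y \<le> (1 - s) * 1 + s * (6 - z)"
      using dominated_by_swap_mixture[of 1 "6 - z" x y] bounds 3 by auto
    show ?thesis
      by (rule capacity_region_mix[OF P Q s(1,2)]) (use bounds s in \<open>auto simp: algebra_simps\<close>)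
  qed
qed

lemma rate_region_ii_subset:
  fixes A :: "3 \<Rightarrow> 3 set"
  assumes C: "\<forall>J\<in>servers. C J = 1"
    and A: "3 \<in> A 1" "1 \<in> A 2" "2 \<in> A 3"
  shows "rate_region 6 6 6 9 \<subseteq> capacity_region A C"
proof (rule rate_region_subsetI)
  fix x y z :: real
  assume R: "vector [x, y, z] \<in> rate_region 6 6 6 9"
  note bounds = R[unfolded rate_region_def, simplified]
  note rates = rate_333_cycle[OF C A] rate_422_cycle[OF C A] rate_242_cycle[OF C A]
    rate_224_cycle[OF C A]
  \<comment> \<open>The pair bounds let at most one coordinate exceed \<open>3\<close>. If it is
    \<open>x\<close>, the triple lies below \<open>(x, 6 - x, 6 - x)\<close>, on the segment from
    \<open>(3, 3, 3)\<close> to \<open>(4, 2, 2)\<close>.\<close>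
  consider "x \<le> 3" "y \<le> 3" "z \<le> 3" | "3 \<le> x" | "3 \<le> y" | "3 \<le> z" by linarith
  then show "vector [x, y, z] \<in> capacity_region A C"
  proof cases
    case 1
    show ?thesis
      by (rule capacity_region_mix[OF rates(1) rates(1), of 0]) (use bounds 1 in auto)
  next
    case 2
    show ?thesis
      by (rule capacity_region_mix[OF rates(1) rates(2), of "x - 3"]) (use bounds 2 in auto)
  next
    case 3
    show ?thesis
      by (rule capacity_region_mix[OF rates(1) rates(3), of "y - 3"]) (use bounds 3 in auto)
  next
    case 4
    show ?thesis
      by (rule capacity_region_mix[OF rates(1) rates(4), of "z - 3"]) (use bounds 4 in auto)
  qed
qed

lemma rate_region_iii_subset:
  fixes A :: "3 \<Rightarrow> 3 set"
  assumes C: "\<forall>J\<in>servers. C J = 1"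
    and A: "3 \<in> A 2" "2 \<in> A 3"
  shows "rate_region 6 6 8 9 \<subseteq> capacity_region A C"
proof (rule rate_region_subsetI)
  fix x y z :: real
  assume R: "vector [x, y, z] \<in> rate_region 6 6 8 9"
  note bounds = R[unfolded rate_region_def, simplified]
  note rates = rate_144[OF C A] rate_243[OF C A] rate_234[OF C A] rate_333[OF C A]
    rate_422[OF C A]
  \<comment> \<open>Slices at fixed \<open>x\<close>: the corners are \<open>(4, 4)\<close>, then
    \<open>(4, 5 - x)\<close> once the bound \<open>9\<close> binds, then \<open>(6 - x, 3)\<close>,
    and finally \<open>(6 - x, 6 - x)\<close>, where the pair bounds imply the sum bound.\<close>
  consider "x \<le> 1" | "1 \<le> x" "x \<le> 2" | "2 \<le> x" "x \<le> 3" | "3 \<le> x" by linarith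
  then show "vector [x, y, z] \<in> capacity_region A C"
  proof cases
    case 1
    show ?thesis
      by (rule capacity_region_mix[OF rates(1) rates(1), of 0]) (use bounds 1 in auto)
  next
    case 2
    have P: "vector [x, 4, 5 - x] \<in> capacity_region A C"
      by (rule capacity_region_mix[OF rates(1) rates(2), of "x - 1"]) (use bounds 2 in auto)
    have Q: "vector [x, 5 - x, 4] \<in> capacity_region A C"
      by (rule capacity_region_mix[OF rates(1) rates(3), of "x - 1"]) (use bounds 2 in auto)
    obtain s where s: "0 \<le> s" "s \<le> 1"
        "y \<le> (1 - s) * 4 + s * (5 - x)" "z \<le> (1 - s) * (5 - x) + s * 4"
      using dominated_by_swap_mixture[of "5 - x" 4 y z] bounds 2 by auto
    show ?thesis
      by (rule capacity_region_mix[OF P Q s(1,2)]) (use bounds s in \<open>auto simp: algebra_simps\<close>)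
  next
    case 3
    have P: "vector [x, 6 - x, 3] \<in> capacity_region A C"
      by (rule capacity_region_mix[OF rates(2) rates(4), of "x - 2"]) (use bounds 3 in auto)
    have Q: "vector [x, 3, 6 - x] \<in> capacity_region A C"
      by (rule capacity_region_mix[OF rates(3) rates(4), of "x - 2"]) (use bounds 3 in auto)
    obtain s where s: "0 \<le> s" "s \<le> 1"
        "y \<le> (1 - s) * (6 - x) + s * 3" "z \<le> (1 - s) * 3 + s * (6 - x)"
      using dominated_by_swap_mixture[of 3 "6 - x" y z] bounds 3 by auto
    show ?thesis
      by (rule capacity_region_mix[OF P Q s(1,2)]) (use bounds s in \<open>auto simp: algebra_simps\<close>)
  next
    case 4
    show ?thesis
      by (rule capacity_region_mix[OF rates(4) rates(5), of "x - 3"]) (use bounds 4 in auto)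
  qed
qed

lemma rate_region_iv_subset:
  fixes A :: "3 \<Rightarrow> 3 set"
  assumes C: "\<forall>J\<in>servers. C J = 1"
    and A: "3 \<in> A 1" "3 \<in> A 2" "2 \<in> A 3"
  shows "rate_region 6 6 8 10 \<subseteq> capacity_region A C"
proof (rule rate_region_subsetI)
  fix x y z :: real
  assume R: "vector [x, y, z] \<in> rate_region 6 6 8 10"
  note bounds = R[unfolded rate_region_def, simplified]
  show "vector [x, y, z] \<in> capacity_region A C"
  proof (cases "x \<le> 2")
    case True
    show ?thesis
      by (rule capacity_region_mix[OF rate_244[OF C A] rate_244[OF C A], of 0])
        (use bounds True in auto)
  next
    \<comment> \<open>Here the pair bounds place the triple below \<open>(x, 6 - x, 6 - x)\<close>,
      on the segment from \<open>(2, 4, 4)\<close> to \<open>(4, 2, 2)\<close>.\<close>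
    case False
    show ?thesis
      by (rule capacity_region_mix[OF rate_244[OF C A] rate_422[OF C A(2,3)], of "(x - 2) / 2"])
        (use bounds False in \<open>auto simp: field_simps\<close>)
  qed
qed

lemma rate_region_v_subset:
  fixes A :: "3 \<Rightarrow> 3 set"
  assumes C: "\<forall>J\<in>servers. C J = 1"
    and A: "3 \<in> A 1" "1 \<in> A 3" "3 \<in> A 2" "2 \<in> A 3"
  shows "rate_region 6 8 8 10 \<subseteq> capacity_region A C"
proof (rule rate_region_subsetI)
  fix x y z :: real
  assume R: "vector [x, y, z] \<in> rate_region 6 8 8 10"
  note bounds = R[unfolded rate_region_def, simplified]
  obtain s where s: "0 \<le> s" "s \<le> 1" "x \<le> (1 - s) * 4 + s * 2" "y \<le> (1 - s) * 2 + s * 4"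
    using dominated_by_swap_mixture[of 2 4 x y] bounds by auto
  show "vector [x, y, z] \<in> capacity_region A C"
    by (rule capacity_region_mix[OF rate_424[OF C A] rate_244[OF C A(1,3,4)] s(1,2)])
      (use bounds s in auto)
qed

lemma rate_region_vi_subset:
  fixes A :: "3 \<Rightarrow> 3 set"
  assumes C: "\<forall>J\<in>servers. C J = 1"
    and A: "2 \<in> A 1" "1 \<in> A 2" "3 \<in> A 1" "1 \<in> A 3" "3 \<in> A 2" "2 \<in> A 3"
  shows "rate_region 8 8 8 12 \<subseteq> capacity_region A C"
proof (rule rate_region_subsetI)
  fix x y z :: real
  assume R: "vector [x, y, z] \<in> rate_region 8 8 8 12"
  note bounds = R[unfolded rate_region_def, simplified]
  show "vector [x, y, z] \<in> capacity_region A C"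
    by (rule capacity_region_mix[OF rate_444[OF C A] rate_444[OF C A], of 0]) (use bounds in auto)
qed

subsection \<open>Outer bounds for three messages\<close>

lemma card_touching:
  fixes K :: "'n::finite set"
  shows "card {J. J \<inter> K \<noteq> {}} = 2 ^ CARD('n) - 2 ^ (CARD('n) - card K)"
proof -
  have "{J. J \<inter> K \<noteq> {}} = UNIV - Pow (- K)"
    by auto
  moreover have "card (UNIV :: 'n set set) = 2 ^ CARD('n)"
    by (simp add: card_Pow Pow_UNIV[symmetric] del: Pow_UNIV)
  ultimately show ?thesis
    by (simp add: card_Diff_subset card_Pow Compl_eq_Diff_UNIV)
qed

lemma closed_rate_region: "closed (rate_region b12 b13 b23 b123)"
  unfolding rate_region_def
  by (intro closed_Collect_conj closed_Collect_le continuous_intros)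

lemma capacity_region_subset_rate_region:
  assumes "\<And>R. (\<And>j. 0 \<le> R $ j) \<Longrightarrow> achievable A R C \<Longrightarrow> R \<in> rate_region b12 b13 b23 b123"
  shows "capacity_region A C \<subseteq> rate_region b12 b13 b23 b123"
  unfolding capacity_region_def using assms by (intro closure_minimal closed_rate_region) auto

text \<open>Of the \<open>8\<close> sets, \<open>2 ^ (3 - card K)\<close> miss \<open>K\<close>; the
  bound is \<open>4\<close>, \<open>6\<close> or \<open>7\<close> for one, two or three
  messages.\<close>

lemma touching_bound3:
  fixes A :: "3 \<Rightarrow> 3 set" and rank :: "3 \<Rightarrow> nat"
  assumes C: "\<forall>J\<in>servers. C J = 1" and "achievable A R C"
    and "\<And>i j. j \<in> K \<Longrightarrow> i \<in> K \<Longrightarrow> i \<in> A j \<Longrightarrow> rank i < rank j"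
  shows "(\<Sum>j\<in>K. R $ j) \<le> real (8 - 2 ^ (3 - card K))"
proof -
  have "(\<Sum>j\<in>K. R $ j) \<le> (\<Sum>J | J \<inter> K \<noteq> {}. C J)"
    using assms(2,3) by (rule achievable_acyclic_bound)
  also have "\<dots> = (\<Sum>J | J \<inter> K \<noteq> {}. 1)"
    using C by (intro sum.cong) (auto simp: servers_def)
  also have "\<dots> = real (8 - 2 ^ (3 - card K))"
    using card_touching[of K] by simp
  finally show ?thesis .
qed

lemma single_bound:
  fixes A :: "3 \<Rightarrow> 3 set"
  assumes C: "\<forall>J\<in>servers. C J = 1" and "achievable A R C" "j \<notin> A j"
  shows "R $ j \<le> 4"
  using touching_bound3[OF assms(1,2), of "{j}" "\<lambda>_. 0"] assms(3) by simp

lemma pair_bound: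
  fixes A :: "3 \<Rightarrow> 3 set"
  assumes C: "\<forall>J\<in>servers. C J = 1" and "achievable A R C"
    and "i \<noteq> j" "i \<notin> A i" "j \<notin> A j" "j \<notin> A i \<or> i \<notin> A j"
  shows "R $ i + R $ j \<le> 6"
proof -
  \<comment> \<open>The rank puts \<open>i\<close> before \<open>j\<close>: receiver
    \<open>j\<close> may know message \<open>i\<close>, but not conversely.\<close>
  have bound: "R $ i + R $ j \<le> 6" if "i \<noteq> j" "i \<notin> A i" "j \<notin> A j" "j \<notin> A i" for i j
    using touching_bound3[OF assms(1,2), of "{i, j}" "\<lambda>l. of_bool (l = j)"] that by auto
  show ?thesis
    using bound[of i j] bound[of j i] assms(3-6) by auto
qed

lemma sum_bound_acyclic:
  fixes A :: "3 \<Rightarrow> 3 set" and rank :: "3 \<Rightarrow> nat"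
  assumes C: "\<forall>J\<in>servers. C J = 1" and "achievable A R C"
    and "\<And>i j. i \<in> A j \<Longrightarrow> rank i < rank j"
  shows "R $ 1 + R $ 2 + R $ 3 \<le> 7"
  using touching_bound3[OF assms(1,2), of UNIV rank] assms(3) by (simp add: sum_3)

text \<open>All seven servers count once, and \<open>{2, 3}\<close> and \<open>{1, 2, 3}\<close>
  once more: \<open>7 + 2\<close>.\<close>

lemma sum_bound_source:
  fixes A :: "3 \<Rightarrow> 3 set"
  assumes C: "\<forall>J\<in>servers. C J = 1" and "achievable A R C" "A 1 = {}" "2 \<notin> A 2" "3 \<notin> A 3"
  shows "R $ 1 + R $ 2 + R $ 3 \<le> 9"
proof -
  have "R $ 1 + R $ 2 + R $ 3 \<le> (\<Sum>J | J \<inter> {1, 2, 3} \<noteq> {}. C J) + (\<Sum>J | {2, 3} \<subseteq> J. C J)"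
    using assms(2-5) by (intro achievable_triple_bound) auto
  also have "(\<Sum>J | J \<inter> {1, 2, 3} \<noteq> {}. C J) = (\<Sum>J::3 set | J \<inter> UNIV \<noteq> {}. 1)"
    using C by (intro sum.cong) (auto simp: servers_def UNIV_3)
  also have "\<dots> = 7"
    using card_touching[of "UNIV :: 3 set"] by simp
  also have "{J. {2, 3} \<subseteq> J} = {{2, 3}, {1, 2, 3} :: 3 set}"
    by (auto simp: set_eq_iff forall_3)
  also have "(\<Sum>J\<in>\<dots>. C J) = 2"
    using C by (simp add: servers_def servers3_neq)
  finally show ?thesis by simp
qed

text \<open>A pair that is not mutual is acyclic and obeys the bound \<open>6\<close>; for a mutual
  pair \<open>8\<close> comes from the single bounds. The premise on the sum may draw on these
  bounds, which suffices in (ii), (iv), (v) and (vi).\<close>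

lemma capacity_region_eqI:
  fixes A :: "3 \<Rightarrow> 3 set"
  assumes C: "\<forall>J\<in>servers. C J = 1" and A: "side_information A"
    and inner: "rate_region b12 b13 b23 b123 \<subseteq> capacity_region A C"
    and b12: "2 \<notin> A 1 \<and> 6 \<le> b12 \<or> 1 \<notin> A 2 \<and> 6 \<le> b12 \<or> 8 \<le> b12"
    and b13: "3 \<notin> A 1 \<and> 6 \<le> b13 \<or> 1 \<notin> A 3 \<and> 6 \<le> b13 \<or> 8 \<le> b13"
    and b23: "3 \<notin> A 2 \<and> 6 \<le> b23 \<or> 2 \<notin> A 3 \<and> 6 \<le> b23 \<or> 8 \<le> b23"
    and sum: "\<And>R. achievable A R C \<Longrightarrow> R $ 1 \<le> 4 \<Longrightarrow> R $ 2 \<le> 4 \<Longrightarrow> R $ 3 \<le> 4 \<Longrightarrow>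
      R $ 1 + R $ 2 \<le> b12 \<Longrightarrow> R $ 1 + R $ 3 \<le> b13 \<Longrightarrow> R $ 2 + R $ 3 \<le> b23 \<Longrightarrow>
      R $ 1 + R $ 2 + R $ 3 \<le> b123"
  shows "capacity_region A C = rate_region b12 b13 b23 b123"
proof (intro equalityI inner capacity_region_subset_rate_region)
  fix R assume nonneg: "\<And>j. 0 \<le> R $ j" and R: "achievable A R C"
  have side: "j \<notin> A j" for j
    using A by (simp add: side_information_def)
  have single: "R $ j \<le> 4" for j
    by (rule single_bound[OF C R side])
  have pair: "R $ i + R $ j \<le> b" if "i \<noteq> j" "j \<notin> A i \<and> 6 \<le> b \<or> i \<notin> A j \<and> 6 \<le> b \<or> 8 \<le> b" for i j b
    using pair_bound[OF C R that(1) side side] single[of i] single[of j] that(2) by linarith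
  have "R $ 1 + R $ 2 \<le> b12" "R $ 1 + R $ 3 \<le> b13" "R $ 2 + R $ 3 \<le> b23"
    using b12 b13 b23 by (auto intro: pair)
  then show "R \<in> rate_region b12 b13 b23 b123"
    using nonneg single sum[OF R] by (simp add: rate_region_def)
qed

section \<open>The six capacity regions\<close>

lemma capacity_region_i:
  assumes C: "\<forall>J\<in>servers. C J = 1" and "A \<in> problems_i"
  shows "capacity_region A C = rate_region 6 6 6 7"
proof -
  \<comment> \<open>All six problems have acyclic side information; each witness is a topological
    order.\<close>
  have "\<exists>rank :: 3 \<Rightarrow> nat. \<forall>j. \<forall>i\<in>A j. rank i < rank j"
    using assms(2) unfolding problems_i_def
  proof (elim insertE emptyE)
    assume "A = problem {} {} {}"
    then show ?thesis by (simp add: problem_def)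
  next
    assume "A = problem {2} {} {}"
    then show ?thesis
      by (intro exI[of _ "\<lambda>j. if j = 1 then 1 else 0"]) (simp add: problem_def)
  next
    assume "A = problem {2, 3} {} {}"
    then show ?thesis
      by (intro exI[of _ "\<lambda>j. if j = 1 then 1 else 0"]) (simp add: problem_def)
  next
    assume "A = problem {} {3} {1}"
    then show ?thesis
      by (intro exI[of _ "\<lambda>j. if j = 1 then 0 else if j = 3 then 1 else 2"]) (simp add: problem_def forall_3)
  next
    assume "A = problem {} {1} {1}"
    then show ?thesis
      by (intro exI[of _ "\<lambda>j. if j = 1 then 0 else 1"]) (simp add: problem_def)
  next
    assume "A = problem {} {1} {1, 2}"
    then show ?thesis
      by (intro exI[of _ "\<lambda>j. if j = 1 then 0 else if j = 2 then 1 else 2"]) (simp add: problem_def forall_3)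
  qed
  then obtain rank :: "3 \<Rightarrow> nat" where rank: "\<And>i j. i \<in> A j \<Longrightarrow> rank i < rank j"
    by blast
  have not_both: "j \<notin> A i \<or> i \<notin> A j" for i j
    using rank[of i j] rank[of j i] by auto
  show ?thesis
  proof (rule capacity_region_eqI[OF C _ rate_region_i_subset[OF C]])
    show "side_information A"
      using rank by (auto simp: side_information_def)
    show "R $ 1 + R $ 2 + R $ 3 \<le> 7" if "achievable A R C" for R
      using C that rank by (rule sum_bound_acyclic)
  qed (use not_both in auto)
qed

text \<open>The sum bound \<open>9\<close> is half the total of the three pair bounds.\<close>

lemma capacity_region_ii:
  assumes C: "\<forall>J\<in>servers. C J = 1" and A: "A \<in> problems_ii"
  shows "capacity_region A C = rate_region 6 6 6 9"
proof (rule capacity_region_eqI[OF C])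
  show "rate_region 6 6 6 9 \<subseteq> capacity_region A C"
    using A by (intro rate_region_ii_subset[OF C]) (auto simp: problems_ii_def problem_def)
qed (use A in \<open>auto simp: problems_ii_def problem_def side_information_def forall_3\<close>)

lemma capacity_region_iii:
  assumes C: "\<forall>J\<in>servers. C J = 1" and A: "A \<in> problems_iii"
  shows "capacity_region A C = rate_region 6 6 8 9"
proof (rule capacity_region_eqI[OF C])
  show "rate_region 6 6 8 9 \<subseteq> capacity_region A C"
    using A by (intro rate_region_iii_subset[OF C]) (auto simp: problems_iii_def problem_def)
  show "R $ 1 + R $ 2 + R $ 3 \<le> 9" if "achievable A R C" for R
    using A by (intro sum_bound_source[OF C that]) (auto simp: problems_iii_def problem_def)
qed (use A in \<open>auto simp: problems_iii_def problem_def side_information_def forall_3\<close>)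

text \<open>The sum bound \<open>10\<close> adds the bound \<open>6\<close> on messages
  \<open>1\<close> and \<open>2\<close> to the bound \<open>4\<close> on message \<open>3\<close>;
  the same works for (v).\<close>

lemma capacity_region_iv:
  assumes C: "\<forall>J\<in>servers. C J = 1" and A: "A \<in> problems_iv"
  shows "capacity_region A C = rate_region 6 6 8 10"
proof (rule capacity_region_eqI[OF C])
  show "rate_region 6 6 8 10 \<subseteq> capacity_region A C"
    using A by (intro rate_region_iv_subset[OF C]) (auto simp: problems_iv_def problem_def)
qed (use A in \<open>auto simp: problems_iv_def problem_def side_information_def forall_3\<close>)

lemma capacity_region_v:
  assumes C: "\<forall>J\<in>servers. C J = 1" and A: "A \<in> problems_v"
  shows "capacity_region A C = rate_region 6 8 8 10"
proof (rule capacity_region_eqI[OF C])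
  show "rate_region 6 8 8 10 \<subseteq> capacity_region A C"
    using A by (intro rate_region_v_subset[OF C]) (auto simp: problems_v_def problem_def)
qed (use A in \<open>auto simp: problems_v_def problem_def side_information_def forall_3\<close>)

lemma capacity_region_vi:
  assumes C: "\<forall>J\<in>servers. C J = 1" and A: "A \<in> problems_vi"
  shows "capacity_region A C = rate_region 8 8 8 12"
proof (rule capacity_region_eqI[OF C])
  show "rate_region 8 8 8 12 \<subseteq> capacity_region A C"
    using A by (intro rate_region_vi_subset[OF C]) (auto simp: problems_vi_def problem_def)
qed (use A in \<open>auto simp: problems_vi_def problem_def side_information_def forall_3\<close>)

subsection \<open>Classification up to relabeling\<close>

definition perm3 :: "3 \<Rightarrow> 3 \<Rightarrow> 3 \<Rightarrow> 3 \<Rightarrow> 3" where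
  "perm3 a b c j = (if j = 1 then a else if j = 2 then b else c)"

text \<open>Only the six off-diagonal memberships need comparing, since
  \<open>side_information\<close> excludes the diagonal ones on both sides.\<close>

lemma is_relabelingI:
  fixes a b c :: 3
  assumes distinct: "a \<noteq> b" "a \<noteq> c" "b \<noteq> c"
    and A: "side_information A" and B: "side_information B"
    and "b \<in> A a \<longleftrightarrow> 2 \<in> B 1" "c \<in> A a \<longleftrightarrow> 3 \<in> B 1"
      "a \<in> A b \<longleftrightarrow> 1 \<in> B 2" "c \<in> A b \<longleftrightarrow> 3 \<in> B 2"
      "a \<in> A c \<longleftrightarrow> 1 \<in> B 3" "b \<in> A c \<longleftrightarrow> 2 \<in> B 3"
  shows "is_relabeling A B"
proof -
  let ?p = "perm3 a b c"
  have inj: "inj ?p"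
    using distinct by (auto simp: inj_def forall_3 perm3_def)
  then have bij: "bij ?p"
    by (simp add: bij_def finite_UNIV_inj_surj)
  have mem: "?p i \<in> A (?p j) \<longleftrightarrow> i \<in> B j" for i j
    using exhaust_3[of i] exhaust_3[of j] A B assms(6-11)
    by (auto simp: perm3_def side_information_def)
  have "A (?p j) = ?p ` B j" for j
  proof (rule set_eqI)
    fix l
    obtain i where "l = ?p i"
      using bij_pointE[OF bij] by metis
    then show "l \<in> A (?p j) \<longleftrightarrow> l \<in> ?p ` B j"
      using mem inj by (simp add: inj_image_mem_iff)
  qed
  then show ?thesis
    using bij unfolding is_relabeling_def by blast
qed

text \<open>Six possible memberships leave 64 patterns, and one of the six permutations carries one
  of the sixteen listed problems to each of them.\<close>

lemma relabeling_problems: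
  assumes A: "side_information A"
  shows "\<exists>B \<in> problems_i \<union> problems_ii \<union> problems_iii \<union> problems_iv \<union> problems_v \<union> problems_vi.
    is_relabeling A B"
proof -
  let ?P = "problems_i \<union> problems_ii \<union> problems_iii \<union> problems_iv \<union> problems_v \<union> problems_vi"
  note problems_defs = problems_i_def problems_ii_def problems_iii_def problems_iv_def
    problems_v_def problems_vi_def problem_def
  define matches where "matches B p \<longleftrightarrow> (case p of (a, b, c) \<Rightarrow>
      (b \<in> A a \<longleftrightarrow> 2 \<in> B 1) \<and> (c \<in> A a \<longleftrightarrow> 3 \<in> B 1) \<and> (a \<in> A b \<longleftrightarrow> 1 \<in> B 2) \<and>
      (c \<in> A b \<longleftrightarrow> 3 \<in> B 2) \<and> (a \<in> A c \<longleftrightarrow> 1 \<in> B 3) \<and> (b \<in> A c \<longleftrightarrow> 2 \<in> B 3))"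
    for B :: "3 \<Rightarrow> 3 set" and p
  let ?perms = "{(1, 2, 3), (1, 3, 2), (2, 1, 3), (2, 3, 1), (3, 1, 2), (3, 2, 1)}"
  \<comment> \<open>Once the listed problems are expanded, the claim is propositional in the six
    memberships of \<open>A\<close>, and each of the 64 cases is evaluated.\<close>
  have "\<exists>B\<in>?P. \<exists>p\<in>?perms. matches B p"
    unfolding problems_defs matches_def
    by (simp add: bex_Un) (cases "2 \<in> A 1"; cases "3 \<in> A 1"; cases "1 \<in> A 2"; cases "3 \<in> A 2"; cases "1 \<in> A 3";
        cases "2 \<in> A 3"; simp only: simp_thms)
  then obtain B p where B: "B \<in> ?P" and p: "p \<in> ?perms" and m: "matches B p"
    by blast
  obtain a b c where abc: "p = (a, b, c)"
    by (cases p)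
  have "\<forall>B\<in>?P. side_information B"
    by (simp add: problems_defs side_information_def forall_3 ball_Un)
  then have "side_information B"
    using B by blast
  then have "is_relabeling A B"
    using p m A by (intro is_relabelingI[of a b c]) (auto simp: abc matches_def)
  then show ?thesis
    using B by blast
qed

theorem mainTheorem5:
  fixes C :: "3 set \<Rightarrow> real"
  assumes "\<forall>J\<in>servers. C J = 1"
  shows "(\<forall>A. side_information A \<longrightarrow>
            (\<exists>B \<in> problems_i \<union> problems_ii \<union> problems_iii \<union> problems_iv \<union> problems_v \<union> problems_vi.
               is_relabeling A B)) \<and>
         (\<forall>A\<in>problems_i. capacity_region A C = rate_region 6 6 6 7) \<and>
         (\<forall>A\<in>problems_ii. capacity_region A C = rate_region 6 6 6 9) \<and>
         (\<forall>A\<in>problems_iii. capacity_region A C = rate_region 6 6 8 9) \<and>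
         (\<forall>A\<in>problems_iv. capacity_region A C = rate_region 6 6 8 10) \<and>
         (\<forall>A\<in>problems_v. capacity_region A C = rate_region 6 8 8 10) \<and>
         (\<forall>A\<in>problems_vi. capacity_region A C = rate_region 8 8 8 12)"
  by (intro conjI allI impI ballI relabeling_problems capacity_region_i[OF assms]
      capacity_region_ii[OF assms] capacity_region_iii[OF assms] capacity_region_iv[OF assms]
      capacity_region_v[OF assms] capacity_region_vi[OF assms])

end
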